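(* Let $A^{1,\dots,\ell+1}$ (with $\ell\ge 1$) be a multipartition matrix that satisfies the generalized running intersection property (GRIP). Then $I(A^{1,\dots,\ell+1})$ can be obtained via a toric fiber product. Precisely: put $B=\Cup_{n=1}^{\ell}A^n$ and $C=A^{\ell+1}$, let $x_u$ ($u\in[\beta]$) and $y_v$ ($v\in[\gamma]$) be positive integers with $\omega_{uv}=x_uy_v$ whenever $\omega_{uv}\neq 0$, and let $\tilde A^{1,\dots,\ell}$, $\tilde A^{\ell+1}$ and the ring homomorphism $\psi$ be as defined in the context. Then $I(\tilde A^{1,\dots,\ell})$ and $I(\tilde A^{\ell+1})$ are homogeneous with respect to the given multigradings, $\ker(\psi)$ is their toric fiber product with respect to these multigradings, and $$I(A^{1,\dots,\ell+1})=\ker(\psi).$$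
   Context: Write $[r]=\{1,\dots,r\}$. A partition matrix with $m$ columns is a $0/1$ matrix each of whose columns has exactly one entry equal to $1$; it is assumed to have no zero rows. A multipartition matrix $A=A^{1,\dots,k}$ with $k$ partitions is the matrix obtained by stacking partition matrices $A^1,\dots,A^k$, all with $m$ columns (the ordered list is part of the data). Let $a^\ell_i$ be the $i$-th row of $A^\ell$ and $I^\ell_i\subset[m]$ its support. $A^{1,\dots,\ell}$ denotes the stacking of the first $\ell$ partitions, and $c^\ell_j$ the number of columns of $A^{1,\dots,\ell}$ equal to its $j$-th column (the $j$-th included). Well-connected: $A$ is well-connected if for every row $a^\ell_u$ with $\ell>1$ one has $c^\ell_j/c^{\ell-1}_j=c^\ell_{j'}/c^{\ell-1}_{j'}$ for all $j,j'\in I^\ell_u$. The matrix $\Cup_{n=1}^{\ell}A^n$: let $\beta$ be the number of distinct columns of $A^{1,\dots,\ell}$ and $\lambda:[m]\to[\beta]$ a surjective labeling with $\lambda(j)=\lambda(j')$ iff the $j$-th and $j'$-th columns of $A^{1,\dots,\ell}$ are equal. Then $\Cup_{n=1}^{\ell}A^n$ is the $\beta\times m$ partition matrix whose $j$-th column is the standard basis vector $e_{\lambda(j)}$. Florets: let $B,C$ be partition matrices with $m$ columns; $BC$ denotes $B$ stacked above $C$ (a multipartition matrix with two partitions). A row of $B$ and a row of $C$ are connected if their supports intersect. $BC$ satisfies the floret condition if for any two rows of $B$, the sets of rows of $C$ connected to them are disjoint or equal. In that case the set of rows of $C$ connected to a given row of $B$ is a floret of $C$; let $\mathcal{F}^C_1,\dots,\mathcal{F}^C_f$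 be the distinct florets of $C$, and $\mathcal{F}^B_t$ the set of rows of $B$ connected to rows of $\mathcal{F}^C_t$. For the $u$-th row of $B$ and the $v$-th row of $C$, $t(u,\bullet)$ and $t(\bullet,v)$ denote the indices with row $u$ of $B$ in $\mathcal{F}^B_{t(u,\bullet)}$ and row $v$ of $C$ in $\mathcal{F}^C_{t(\bullet,v)}$; rows $u,v$ are connected iff $t(u,\bullet)=t(\bullet,v)$, and then this common value is $t(u,v)$. $B\Cap C$ is the $f\times m$ matrix whose $(t,j)$ entry is $1$ if the row of $C$ having $j$ in its support lies in $\mathcal{F}^C_t$, and $0$ otherwise. GRIP: with $B_h=\Cup_{n=1}^{h}A^n$, the matrix $A^{1,\dots,k}$ satisfies the GRIP if for each $h\in[k-1]$: (1) $B_h A^{h+1}$ is well-connected; (2) $B_h A^{h+1}$ satisfies the floret condition; (3) the rows of $B_h\Cap A^{h+1}$ lie in the rowspan of $A^{1,\dots,h}$. Toric ideals: for an integer matrix $M$ with nonnegative entries, $I(M)=\langle p^a-p^b: a,b \text{ nonnegative integer vectors with } Ma=Mb\rangle$ in the polynomial ring over $\mathbb{C}$ with one variable per column of $M$. Column indexing: $C=A^{\ell+1}$ has $\gamma$ rows; $\omega_{uv}$ is the number of columns of $BC$ of the form $(e_u,e_v)^T$. Columns of $A^{1,\dots,\ell+1}$ (equivalently of $BC$) are indexed by triples $(u,v,s)$, $s\in\{0,\dots,\omega_{uv}-1\}$, where $(u,v,s)$ is the $(s+1)$-st column of $BC$ of the form $(e_u,e_v)^T$. Under the GRIP, positive integers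 $x_u,y_v$ with $\omega_{uv}=x_uy_v$ whenever $\omega_{uv}\ne0$ exist. Define $R=\mathbb{C}[p^{t(u,v)}_{u,v,s}]$ (variables for all column indices $(u,v,s)$), $R_B=\mathbb{C}[q^{t(u,\bullet)}_{u,s'}: u\in[\beta],\,0\le s'\le x_u-1]$, $R_C=\mathbb{C}[r^{t(\bullet,v)}_{v,s''}: v\in[\gamma],\,0\le s''\le y_v-1]$, with multigradings $\deg q^{t(u,\bullet)}_{u,s'}=e_{t(u,\bullet)}$, $\deg r^{t(\bullet,v)}_{v,s''}=e_{t(\bullet,v)}$ in $\mathbb{Z}^f$. $\tilde A^{1,\dots,\ell}$ has columns indexed by $(u,s')$, $0\le s'\le x_u-1$, its $(u,s')$ column being the column of $A^{1,\dots,\ell}$ with label $u$ under $\lambda$; $\tilde A^{\ell+1}$ has columns indexed by $(v,s'')$, $0\le s''\le y_v-1$, its $(v,s'')$ column being $e_v$. The toric ideals $I(A^{1,\dots,\ell+1})$, $I(\tilde A^{1,\dots,\ell})$, $I(\tilde A^{\ell+1})$ live in $R,R_B,R_C$. The map is $$\psi:R\to R_B/I(\tilde A^{1,\dots,\ell})\otimes_{\mathbb{C}}R_C/I(\tilde A^{\ell+1}),\qquad p^{t(u,v)}_{u,v,s}\mapsto q^{t(u,\bullet)}_{u,s'}\otimes r^{t(\bullet,v)}_{v,s''},$$ where $s=s'y_v+s''$ with $0\le s'\le x_u-1$, $0\le s''\le y_v-1$. Toric fiber product: given ideals $I\subset\mathbb{C}[x^i_j]$, $J\subset\mathbb{C}[y^i_k]$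 homogeneous with respect to multigradings $\deg x^i_j=\deg y^i_k=\mathbf{d}^i$, the toric fiber product is the kernel of $\mathbb{C}[z^i_{jk}]\to\mathbb{C}[x]/I\otimes_{\mathbb{C}}\mathbb{C}[y]/J$, $z^i_{jk}\mapsto x^i_j\otimes y^i_k$, with one variable $z^i_{jk}$ for each pair $(x^i_j,y^i_k)$ of the same superscript $i$. *)

theory Defs
  imports "Jordan_Normal_Form.VS_Connect" "HOL-Algebra.QuotRing" "HOL-Library.Poly_Mapping"
begin

text \<open>
  Rows, columns, labels and florets are numbered from 0, so \<open>[r]\<close> is \<open>{..<r}\<close>.
  In a list \<open>As\<close> of partition matrices the entry \<open>As ! n\<close> is the partition \<open>A\<^sup>n\<^sup>+\<^sup>1\<close>.
\<close>

section \<open>Multipartition matrices\<close>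

definition partition_matrix :: "nat \<Rightarrow> nat mat \<Rightarrow> bool" where
  "partition_matrix m M \<longleftrightarrow>
     dim_col M = m \<and>
     (\<forall>i<dim_row M. \<forall>j<m. M $$ (i, j) \<in> {0, 1}) \<and>
     (\<forall>j<m. \<exists>!i. i < dim_row M \<and> M $$ (i, j) = 1) \<and>
     (\<forall>i<dim_row M. row M i \<noteq> 0\<^sub>v m)"

definition multipartition :: "nat \<Rightarrow> nat mat list \<Rightarrow> bool" where
  "multipartition m As \<longleftrightarrow> (\<forall>M\<in>set As. partition_matrix m M)"

definition stack :: "nat \<Rightarrow> nat mat list \<Rightarrow> nat mat" where
  "stack m As = mat_of_rows m (concat (map rows As))"

definition row_support :: "nat mat \<Rightarrow> nat \<Rightarrow> nat set" where
  "row_support M i = {j. j < dim_col M \<and> M $$ (i, j) \<noteq> 0}"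

definition col_count :: "nat mat \<Rightarrow> nat \<Rightarrow> nat" where
  "col_count M j = card {j'. j' < dim_col M \<and> col M j' = col M j}"

definition well_connected :: "nat \<Rightarrow> nat mat list \<Rightarrow> bool" where
  "well_connected m As \<longleftrightarrow>
     (\<forall>l u. 1 < l \<and> l \<le> length As \<and> u < dim_row (As ! (l - 1)) \<longrightarrow>
       (\<forall>j\<in>row_support (As ! (l - 1)) u. \<forall>j'\<in>row_support (As ! (l - 1)) u.
          (of_nat (col_count (stack m (take l As)) j) :: rat)
            / of_nat (col_count (stack m (take (l - 1) As)) j)
          = of_nat (col_count (stack m (take l As)) j')
            / of_nat (col_count (stack m (take (l - 1) As)) j')))"

definition num_cols :: "nat mat \<Rightarrow> nat" where
  "num_cols M = card (set (cols M))"

definition labeling :: "nat mat \<Rightarrow> (nat \<Rightarrow> nat) \<Rightarrow> bool" where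
  "labeling M lam \<longleftrightarrow>
     lam ` {..<dim_col M} = {..<num_cols M} \<and>
     (\<forall>j<dim_col M. \<forall>j'<dim_col M. lam j = lam j' \<longleftrightarrow> col M j = col M j')"

text \<open>
  \<open>Cup M lam\<close> with \<open>M = A\<^sup>1\<^sup>,\<^sup>\<dots>\<^sup>,\<^sup>l\<close> is \<open>\<Union>\<^sub>n\<^sub>\<le>\<^sub>l A\<^sup>n\<close>. It depends on the chosen labeling of
  the distinct columns only through the order of its rows.
\<close>

definition Cup :: "nat mat \<Rightarrow> (nat \<Rightarrow> nat) \<Rightarrow> nat mat" where
  "Cup M lam = mat_of_cols (num_cols M) (map (\<lambda>j. unit_vec (num_cols M) (lam j)) [0..<dim_col M])"

definition connected_rows :: "nat mat \<Rightarrow> nat mat \<Rightarrow> nat \<Rightarrow> nat \<Rightarrow> bool" where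
  "connected_rows B C u v \<longleftrightarrow> row_support B u \<inter> row_support C v \<noteq> {}"

definition neighbours :: "nat mat \<Rightarrow> nat mat \<Rightarrow> nat \<Rightarrow> nat set" where
  "neighbours B C u = {v. v < dim_row C \<and> connected_rows B C u v}"

definition floret_condition :: "nat mat \<Rightarrow> nat mat \<Rightarrow> bool" where
  "floret_condition B C \<longleftrightarrow>
     (\<forall>u<dim_row B. \<forall>u'<dim_row B.
        neighbours B C u \<inter> neighbours B C u' = {} \<or> neighbours B C u = neighbours B C u')"

text \<open>\<open>Fs\<close> lists the distinct florets of \<open>C\<close>, in an arbitrary order.\<close>

definition floret_list :: "nat mat \<Rightarrow> nat mat \<Rightarrow> nat set list \<Rightarrow> bool" where
  "floret_list B C Fs \<longleftrightarrow> distinct Fs \<and> set Fs = neighbours B C ` {..<dim_row B}"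

definition floret_of_C :: "nat set list \<Rightarrow> nat \<Rightarrow> nat" where
  "floret_of_C Fs v = (THE t. t < length Fs \<and> v \<in> Fs ! t)"

definition floret_rows_B :: "nat mat \<Rightarrow> nat mat \<Rightarrow> nat set list \<Rightarrow> nat \<Rightarrow> nat set" where
  "floret_rows_B B C Fs t = {u. u < dim_row B \<and> (\<exists>v\<in>Fs ! t. connected_rows B C u v)}"

definition floret_of_B :: "nat mat \<Rightarrow> nat mat \<Rightarrow> nat set list \<Rightarrow> nat \<Rightarrow> nat" where
  "floret_of_B B C Fs u = (THE t. t < length Fs \<and> u \<in> floret_rows_B B C Fs t)"

definition Cap :: "nat mat \<Rightarrow> nat set list \<Rightarrow> nat mat" where
  "Cap C Fs = mat (length Fs) (dim_col C)
     (\<lambda>(t, j). if \<exists>v\<in>Fs ! t. j \<in> row_support C v then 1 else 0)"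

text \<open>
  The three conditions are insensitive to the labeling of the columns and to the order of the
  florets, and both always exist, so quantifying over all of them expresses the same condition as
  fixing one choice.
\<close>

definition GRIP :: "nat \<Rightarrow> nat mat list \<Rightarrow> bool" where
  "GRIP m As \<longleftrightarrow>
     (\<forall>h lam. 1 \<le> h \<and> h < length As \<and> labeling (stack m (take h As)) lam \<longrightarrow>
       (let B = Cup (stack m (take h As)) lam; C = As ! h in
          well_connected m [B, C] \<and>
          floret_condition B C \<and>
          (\<forall>Fs. floret_list B C Fs \<longrightarrow>
             set (rows (map_mat real (Cap C Fs)))
               \<subseteq> vec_space.row_space m (map_mat real (stack m (take h As))))))"

lemma labeling_exists: "\<exists>lam. labeling M lam"
proof -
  have "card (set (cols M)) = card {..<num_cols M}" by (simp only: num_cols_def card_lessThan)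
  then obtain g where g: "bij_betw g (set (cols M)) {..<num_cols M}"
    using finite_same_card_bij[OF finite_set finite_lessThan] by blast
  have cols: "set (cols M) = col M ` {..<dim_col M}" by (simp only: cols_def set_map set_upt lessThan_atLeast0)
  have inj: "g (col M j) = g (col M j') \<longleftrightarrow> col M j = col M j'" if "j < dim_col M" "j' < dim_col M" for j j'
    using inj_on_eq_iff[OF bij_betw_imp_inj_on[OF g]] that unfolding cols by blast
  have "(\<lambda>j. g (col M j)) ` {..<dim_col M} = {..<num_cols M}"
    using bij_betw_imp_surj_on[OF g] unfolding cols image_image .
  with inj have "labeling M (\<lambda>j. g (col M j))" unfolding labeling_def by blast
  then show ?thesis by (intro exI[of "labeling M"])
qed

section \<open>Polynomial rings and toric ideals\<close>

type_synonym 'x mpoly = "('x \<Rightarrow>\<^sub>0 nat) \<Rightarrow>\<^sub>0 complex"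

definition mpoly_ring :: "'x set \<Rightarrow> 'x mpoly ring" where
  "mpoly_ring X =
     \<lparr>carrier = {p. \<forall>a\<in>Poly_Mapping.keys p. Poly_Mapping.keys a \<subseteq> X},
      mult = (*), one = 1, zero = 0, add = (+)\<rparr>"

definition const :: "complex \<Rightarrow> 'x mpoly" where
  "const c = Poly_Mapping.single 0 c"

definition monomial :: "('x \<Rightarrow>\<^sub>0 nat) \<Rightarrow> 'x mpoly" where
  "monomial a = Poly_Mapping.single a 1"

definition var :: "'x \<Rightarrow> 'x mpoly" where
  "var i = monomial (Poly_Mapping.single i 1)"

text \<open>
  The evaluation of a polynomial in a commutative \<open>\<complex>\<close>-algebra \<open>T\<close> with structure map \<open>\<eta>\<close>, sending
  the variable \<open>i\<close> to \<open>\<phi> i\<close>: the \<open>\<complex>\<close>-algebra homomorphism determined by the images of the variables.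
\<close>

definition mpoly_eval ::
  "('t, 'e) ring_scheme \<Rightarrow> (complex \<Rightarrow> 't) \<Rightarrow> ('x \<Rightarrow> 't) \<Rightarrow> 'x mpoly \<Rightarrow> 't" where
  "mpoly_eval T \<eta> \<phi> p =
     (\<Oplus>\<^bsub>T\<^esub>a\<in>Poly_Mapping.keys p. \<eta> (Poly_Mapping.lookup p a) \<otimes>\<^bsub>T\<^esub> (\<Otimes>\<^bsub>T\<^esub>i\<in>Poly_Mapping.keys a. \<phi> i [^]\<^bsub>T\<^esub> Poly_Mapping.lookup a i))"

text \<open>
  A matrix \<open>M\<close> with \<open>n\<close> rows whose columns are indexed by the finite set \<open>X\<close>; \<open>M i x\<close> is the entry
  in row \<open>i\<close> and column \<open>x\<close>.
\<close>

definition toric_ideal :: "nat \<Rightarrow> 'x set \<Rightarrow> (nat \<Rightarrow> 'x \<Rightarrow> nat) \<Rightarrow> 'x mpoly set" where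
  "toric_ideal n X M = Idl\<^bsub>mpoly_ring X\<^esub>
     {monomial a - monomial b | a b. Poly_Mapping.keys a \<subseteq> X \<and> Poly_Mapping.keys b \<subseteq> X \<and>
        (\<forall>i<n. (\<Sum>x\<in>X. M i x * Poly_Mapping.lookup a x) = (\<Sum>x\<in>X. M i x * Poly_Mapping.lookup b x))}"

text \<open>Multigradings by \<open>\<int>\<^sup>f\<close>: \<open>deg x\<close> is the degree of the variable \<open>x\<close>.\<close>

definition multidegree :: "nat \<Rightarrow> ('x \<Rightarrow> int vec) \<Rightarrow> ('x \<Rightarrow>\<^sub>0 nat) \<Rightarrow> int vec" where
  "multidegree f deg a = vec f (\<lambda>t. \<Sum>x\<in>Poly_Mapping.keys a. int (Poly_Mapping.lookup a x) * deg x $ t)"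

definition homogeneous :: "nat \<Rightarrow> ('x \<Rightarrow> int vec) \<Rightarrow> 'x mpoly \<Rightarrow> bool" where
  "homogeneous f deg p \<longleftrightarrow> (\<exists>d. \<forall>a\<in>Poly_Mapping.keys p. multidegree f deg a = d)"

definition homogeneous_ideal :: "nat \<Rightarrow> 'x set \<Rightarrow> ('x \<Rightarrow> int vec) \<Rightarrow> 'x mpoly set \<Rightarrow> bool" where
  "homogeneous_ideal f X deg I \<longleftrightarrow>
     ideal I (mpoly_ring X) \<and> I = Idl\<^bsub>mpoly_ring X\<^esub> {p \<in> I. homogeneous f deg p}"

section \<open>Tensor products of commutative algebras over the complex numbers\<close>

text \<open>
  A \<open>\<complex>\<close>-algebra is a ring \<open>A\<close> together with its structure map \<open>\<alpha> :: complex \<Rightarrow> _\<close>, so that the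
  scalar multiple of \<open>a\<close> by \<open>c\<close> is \<open>\<alpha> c \<otimes> a\<close>. The free \<open>\<complex>\<close>-vector space on the set
  \<open>carrier A \<times> carrier B\<close> is made into an algebra by \<open>(a, b) (a', b') = (a a', b b')\<close> on basis
  vectors. The span of the bilinearity relations is an ideal of it, as the product of a relation and
  a basis vector is again a relation, and the quotient is \<open>A \<otimes>\<^sub>\<complex> B\<close>.
\<close>

definition free_mult ::
  "('a, 'e) ring_scheme \<Rightarrow> ('b, 'h) ring_scheme \<Rightarrow>
   ('a \<times> 'b \<Rightarrow>\<^sub>0 complex) \<Rightarrow> ('a \<times> 'b \<Rightarrow>\<^sub>0 complex) \<Rightarrow> ('a \<times> 'b \<Rightarrow>\<^sub>0 complex)" where
  "free_mult A B f g =
     (\<Sum>p\<in>Poly_Mapping.keys f. \<Sum>q\<in>Poly_Mapping.keys g.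
        Poly_Mapping.single (fst p \<otimes>\<^bsub>A\<^esub> fst q, snd p \<otimes>\<^bsub>B\<^esub> snd q) (Poly_Mapping.lookup f p * Poly_Mapping.lookup g q))"

definition free_algebra ::
  "('a, 'e) ring_scheme \<Rightarrow> ('b, 'h) ring_scheme \<Rightarrow> ('a \<times> 'b \<Rightarrow>\<^sub>0 complex) ring" where
  "free_algebra A B =
     \<lparr>carrier = {f. Poly_Mapping.keys f \<subseteq> carrier A \<times> carrier B}, mult = free_mult A B,
      one = Poly_Mapping.single (\<one>\<^bsub>A\<^esub>, \<one>\<^bsub>B\<^esub>) 1, zero = 0, add = (+)\<rparr>"

definition bilinear_relations ::
  "('a, 'e) ring_scheme \<Rightarrow> (complex \<Rightarrow> 'a) \<Rightarrow> ('b, 'h) ring_scheme \<Rightarrow> (complex \<Rightarrow> 'b) \<Rightarrow>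
   ('a \<times> 'b \<Rightarrow>\<^sub>0 complex) set" where
  "bilinear_relations A \<alpha> B \<beta> =
     {Poly_Mapping.single (a \<oplus>\<^bsub>A\<^esub> a', b) 1 - Poly_Mapping.single (a, b) 1 - Poly_Mapping.single (a', b) 1
        | a a' b. a \<in> carrier A \<and> a' \<in> carrier A \<and> b \<in> carrier B} \<union>
     {Poly_Mapping.single (a, b \<oplus>\<^bsub>B\<^esub> b') 1 - Poly_Mapping.single (a, b) 1 - Poly_Mapping.single (a, b') 1
        | a b b'. a \<in> carrier A \<and> b \<in> carrier B \<and> b' \<in> carrier B} \<union>
     {Poly_Mapping.single (\<alpha> c \<otimes>\<^bsub>A\<^esub> a, b) 1 - Poly_Mapping.single (a, b) c
        | c a b. a \<in> carrier A \<and> b \<in> carrier B} \<union>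
     {Poly_Mapping.single (a, \<beta> c \<otimes>\<^bsub>B\<^esub> b) 1 - Poly_Mapping.single (a, b) c
        | c a b. a \<in> carrier A \<and> b \<in> carrier B}"

definition tensor_ideal ::
  "('a, 'e) ring_scheme \<Rightarrow> (complex \<Rightarrow> 'a) \<Rightarrow> ('b, 'h) ring_scheme \<Rightarrow> (complex \<Rightarrow> 'b) \<Rightarrow>
   ('a \<times> 'b \<Rightarrow>\<^sub>0 complex) set" where
  "tensor_ideal A \<alpha> B \<beta> = Idl\<^bsub>free_algebra A B\<^esub> (bilinear_relations A \<alpha> B \<beta>)"

definition tensor_product ::
  "('a, 'e) ring_scheme \<Rightarrow> (complex \<Rightarrow> 'a) \<Rightarrow> ('b, 'h) ring_scheme \<Rightarrow> (complex \<Rightarrow> 'b) \<Rightarrow>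
   ('a \<times> 'b \<Rightarrow>\<^sub>0 complex) set ring" where
  "tensor_product A \<alpha> B \<beta> = free_algebra A B Quot tensor_ideal A \<alpha> B \<beta>"

definition pure_tensor ::
  "('a, 'e) ring_scheme \<Rightarrow> (complex \<Rightarrow> 'a) \<Rightarrow> ('b, 'h) ring_scheme \<Rightarrow> (complex \<Rightarrow> 'b) \<Rightarrow>
   'a \<Rightarrow> 'b \<Rightarrow> ('a \<times> 'b \<Rightarrow>\<^sub>0 complex) set" where
  "pure_tensor A \<alpha> B \<beta> a b =
     tensor_ideal A \<alpha> B \<beta> +>\<^bsub>free_algebra A B\<^esub> Poly_Mapping.single (a, b) 1"

text \<open>\<open>\<complex>[X]/I \<otimes>\<^sub>\<complex> \<complex>[Y]/J\<close>, and the element \<open>p \<otimes> q\<close> for polynomials \<open>p\<close>, \<open>q\<close>.\<close>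

definition quot_class :: "'x set \<Rightarrow> 'x mpoly set \<Rightarrow> 'x mpoly \<Rightarrow> 'x mpoly set" where
  "quot_class X I p = I +>\<^bsub>mpoly_ring X\<^esub> p"

definition quot_tensor ::
  "'x set \<Rightarrow> 'x mpoly set \<Rightarrow> 'y set \<Rightarrow> 'y mpoly set \<Rightarrow>
   ('x mpoly set \<times> 'y mpoly set \<Rightarrow>\<^sub>0 complex) set ring" where
  "quot_tensor X I Y J =
     tensor_product (mpoly_ring X Quot I) (\<lambda>c. quot_class X I (const c))
                    (mpoly_ring Y Quot J) (\<lambda>c. quot_class Y J (const c))"

definition quot_pure ::
  "'x set \<Rightarrow> 'x mpoly set \<Rightarrow> 'y set \<Rightarrow> 'y mpoly set \<Rightarrow> 'x mpoly \<Rightarrow> 'y mpoly \<Rightarrow>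
   ('x mpoly set \<times> 'y mpoly set \<Rightarrow>\<^sub>0 complex) set" where
  "quot_pure X I Y J p q =
     pure_tensor (mpoly_ring X Quot I) (\<lambda>c. quot_class X I (const c))
                 (mpoly_ring Y Quot J) (\<lambda>c. quot_class Y J (const c))
                 (quot_class X I p) (quot_class Y J q)"

section \<open>Toric fiber products\<close>

text \<open>
  \<open>tx\<close> and \<open>ty\<close> give the superscripts of the variables of the two rings.
\<close>

definition tfp_vars :: "'x set \<Rightarrow> ('x \<Rightarrow> 'i) \<Rightarrow> 'y set \<Rightarrow> ('y \<Rightarrow> 'i) \<Rightarrow> ('x \<times> 'y) set" where
  "tfp_vars X tx Y ty = {(j, k). j \<in> X \<and> k \<in> Y \<and> tx j = ty k}"

definition toric_fiber_product ::
  "'x set \<Rightarrow> ('x \<Rightarrow> 'i) \<Rightarrow> 'x mpoly set \<Rightarrow> 'y set \<Rightarrow> ('y \<Rightarrow> 'i) \<Rightarrow> 'y mpoly set \<Rightarrow>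
   ('x \<times> 'y) mpoly set" where
  "toric_fiber_product X tx I Y ty J =
     a_kernel (mpoly_ring (tfp_vars X tx Y ty)) (quot_tensor X I Y J)
       (mpoly_eval (quot_tensor X I Y J) (\<lambda>c. quot_pure X I Y J (const c) 1)
          (\<lambda>(j, k). quot_pure X I Y J (var j) (var k)))"

definition rename_vars :: "'z set \<Rightarrow> ('x \<Rightarrow> 'z) \<Rightarrow> 'x mpoly \<Rightarrow> 'z mpoly" where
  "rename_vars Z \<sigma> = mpoly_eval (mpoly_ring Z) const (\<lambda>i. var (\<sigma> i))"

section \<open>The column indexing and the map \<open>\<psi>\<close>\<close>

definition cols_of_form :: "nat mat \<Rightarrow> nat mat \<Rightarrow> nat \<Rightarrow> nat \<Rightarrow> nat set" where
  "cols_of_form B C u v =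
     {j. j < dim_col C \<and>
         col (stack (dim_col C) [B, C]) j = unit_vec (dim_row B) u @\<^sub>v unit_vec (dim_row C) v}"

definition omega :: "nat mat \<Rightarrow> nat mat \<Rightarrow> nat \<Rightarrow> nat \<Rightarrow> nat" where
  "omega B C u v = card (cols_of_form B C u v)"

definition col_index :: "nat mat \<Rightarrow> nat mat \<Rightarrow> (nat \<times> nat \<times> nat) set" where
  "col_index B C = {(u, v, s). u < dim_row B \<and> v < dim_row C \<and> s < omega B C u v}"

definition col_position :: "nat mat \<Rightarrow> nat mat \<Rightarrow> nat \<times> nat \<times> nat \<Rightarrow> nat" where
  "col_position B C = (\<lambda>(u, v, s). sorted_list_of_set (cols_of_form B C u v) ! s)"

text \<open>
  \<open>M\<close> being \<open>A\<^sup>1\<^sup>,\<^sup>\<dots>\<^sup>,\<^sup>l\<close>: its columns with label \<open>u\<close> are all equal, so any of them may be chosen.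
\<close>

definition tilde_A :: "nat mat \<Rightarrow> (nat \<Rightarrow> nat) \<Rightarrow> nat \<Rightarrow> nat \<times> nat \<Rightarrow> nat" where
  "tilde_A M lam i = (\<lambda>(u, s'). M $$ (i, SOME j. j < dim_col M \<and> lam j = u))"

definition tilde_C :: "nat mat \<Rightarrow> nat \<Rightarrow> nat \<times> nat \<Rightarrow> nat" where
  "tilde_C C i = (\<lambda>(v, s''). unit_vec (dim_row C) v $ i)"

text \<open>\<open>s = s' y\<^sub>v + s''\<close> with \<open>0 \<le> s'' < y\<^sub>v\<close>.\<close>

definition split_index :: "(nat \<Rightarrow> nat) \<Rightarrow> nat \<times> nat \<times> nat \<Rightarrow> (nat \<times> nat) \<times> (nat \<times> nat)" where
  "split_index y = (\<lambda>(u, v, s). ((u, s div y v), (v, s mod y v)))"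

definition psi ::
  "(nat \<times> nat) set \<Rightarrow> (nat \<times> nat) mpoly set \<Rightarrow> (nat \<times> nat) set \<Rightarrow> (nat \<times> nat) mpoly set \<Rightarrow>
   (nat \<Rightarrow> nat) \<Rightarrow> (nat \<times> nat \<times> nat) mpoly \<Rightarrow>
   ((nat \<times> nat) mpoly set \<times> (nat \<times> nat) mpoly set \<Rightarrow>\<^sub>0 complex) set" where
  "psi X I Y J y =
     mpoly_eval (quot_tensor X I Y J) (\<lambda>c. quot_pure X I Y J (const c) 1)
       (\<lambda>i. case split_index y i of (j, k) \<Rightarrow> quot_pure X I Y J (var j) (var k))"

end

theory Submission
  imports Defs "HOL-Library.Function_Algebras" "HOL-Library.Product_Plus"
begin

text \<open>
  A toric ideal is the kernel of the monomial map that records the weight \<open>M a\<close> of each exponent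
  vector \<open>a\<close>. If \<open>\<theta>\<close> is the product of the monomial maps of \<open>tilde_A\<close> and \<open>tilde_C\<close>, then \<open>\<theta>\<close> is
  defined on the tensor product of the two quotients and shows that the tensors of monomials of
  distinct weights are linearly independent. Hence a polynomial is in the kernel of \<open>\<psi>\<close> iff, for
  every pair of weights, the coefficients of the monomials that are sent to it add up to 0. The column
  \<open>(u, v, s)\<close> of \<open>A\<^sup>1\<^sup>,\<^sup>\<dots>\<^sup>,\<^sup>l\<^sup>+\<^sup>1\<close> is the column \<open>u\<close> of \<open>A\<^sup>1\<^sup>,\<^sup>\<dots>\<^sup>,\<^sup>l\<close> above \<open>e\<^sub>v\<close>, so the same condition
  describes \<open>I(A\<^sup>1\<^sup>,\<^sup>\<dots>\<^sup>,\<^sup>l\<^sup>+\<^sup>1)\<close>. The floret condition makes \<open>u\<close> and \<open>v\<close> connected iff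
  their floret indices agree, and the row space condition makes the multidegree a linear function of the
  weight, which gives homogeneity.
\<close>

section \<open>Push-forward of finitely supported functions\<close>

text \<open>On polynomials, with \<open>g\<close> acting on exponent vectors, this is the linear map
  sending each monomial to the basis element of its weight; coefficients over one fibre of
  \<open>g\<close> add up. On a single exponent vector, with \<open>g\<close> acting on variables,
  it is the exponent vector after substitution. Both uses are combined below as
  \<open>pushforward (pushforward \<sigma>)\<close>.\<close>

definition pushforward :: "('a \<Rightarrow> 'b) \<Rightarrow> ('a \<Rightarrow>\<^sub>0 'c::comm_monoid_add) \<Rightarrow> 'b \<Rightarrow>\<^sub>0 'c" where
  "pushforward g p = (\<Sum>k\<in>Poly_Mapping.keys p. Poly_Mapping.single (g k) (Poly_Mapping.lookup p k))"

lemma poly_mapping_expand: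
  "(\<Sum>k\<in>Poly_Mapping.keys p. Poly_Mapping.single k (Poly_Mapping.lookup p k)) = p"
  by (rule poly_mapping_eqI)
    (auto simp: lookup_sum lookup_single when_def in_keys_iff)

text \<open>The case \<open>single\<close> is asked only for keys of the given \<open>p\<close>, so
  that hypotheses on the support of \<open>p\<close> are still available on basis vectors.\<close>

lemma poly_mapping_additive_induct [case_names zero single plus]:
  fixes p :: "'a \<Rightarrow>\<^sub>0 'c::comm_monoid_add"
  assumes "P 0" and "\<And>k c. k \<in> Poly_Mapping.keys p \<Longrightarrow> P (Poly_Mapping.single k c)"
    and "\<And>q r. P q \<Longrightarrow> P r \<Longrightarrow> P (q + r)"
  shows "P p"
proof -
  have "P (\<Sum>k\<in>K. Poly_Mapping.single k (Poly_Mapping.lookup p k))"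
    if "finite K" "K \<subseteq> Poly_Mapping.keys p" for K
    using that by induction (auto intro: assms)
  from this[of "Poly_Mapping.keys p"] show ?thesis by (simp add: poly_mapping_expand)
qed

lemma pushforward_zero [simp]: "pushforward g 0 = 0"
  by (simp add: pushforward_def)

lemma pushforward_single [simp]: "pushforward g (Poly_Mapping.single k c) = Poly_Mapping.single (g k) c"
  by (simp add: pushforward_def)

lemma pushforward_add: "pushforward g (p + q) = pushforward g p + pushforward g q"
  unfolding pushforward_def by (rule setsum_keys_plus_distrib) (simp_all add: single_add)

lemma pushforward_diff:
  fixes p q :: "'a \<Rightarrow>\<^sub>0 'c::ab_group_add"
  shows "pushforward g (p - q) = pushforward g p - pushforward g q"
  using pushforward_add[of g "p - q" q] by (simp add: algebra_simps)

lemma pushforward_pushforward: "pushforward g (pushforward h p) = pushforward (\<lambda>k. g (h k)) p"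
  by (induction p rule: poly_mapping_additive_induct) (simp_all add: pushforward_add)

lemma pushforward_cong:
  "(\<And>k. k \<in> Poly_Mapping.keys p \<Longrightarrow> g k = h k) \<Longrightarrow> pushforward g p = pushforward h p"
  by (simp add: pushforward_def)

lemma pushforward_ident [simp]: "pushforward (\<lambda>k. k) p = p"
  by (simp add: pushforward_def poly_mapping_expand)

lemma keys_pushforward: "Poly_Mapping.keys (pushforward g p) \<subseteq> g ` Poly_Mapping.keys p"
proof
  fix k assume "k \<in> Poly_Mapping.keys (pushforward g p)"
  then have "Poly_Mapping.lookup (pushforward g p) k \<noteq> 0" by (simp add: in_keys_iff)
  then show "k \<in> g ` Poly_Mapping.keys p"
    by (auto simp: pushforward_def lookup_sum lookup_single when_def elim!: sum.not_neutral_contains_not_neutral split: if_splits)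
qed

lemma keys_pushforward_subset:
  "Poly_Mapping.keys p \<subseteq> Z \<Longrightarrow> g ` Z \<subseteq> X \<Longrightarrow> Poly_Mapping.keys (pushforward g p) \<subseteq> X"
  using keys_pushforward[of g p] by blast

text \<open>Both sides are biadditive, so two additive inductions reduce the claim to a product of
  two terms, where it is the additivity of \<open>w\<close>. Together with linearity this makes the
  push-forward the ring map behind a toric ideal.\<close>

lemma pushforward_mult:
  fixes p q :: "'a::monoid_add \<Rightarrow>\<^sub>0 'c::semiring_0" and w :: "'a \<Rightarrow> 'b::monoid_add"
  assumes "\<And>a b. w (a + b) = w a + w b"
  shows "pushforward w (p * q) = pushforward w p * pushforward w q"
proof (induction p rule: poly_mapping_additive_induct)
  case (single k c)
  show ?case
    by (induction q rule: poly_mapping_additive_induct)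
      (simp_all add: pushforward_add distrib_left mult_single assms)
qed (simp_all add: pushforward_add distrib_right)

text \<open>Change of variables for weights: substituting along \<open>g\<close> in the exponent
  vector amounts to pulling the columns of the matrix back along \<open>g\<close>. It is used to
  compare the weights of \<open>tilde_A\<close> and \<open>tilde_C\<close> with those of the stacked
  matrix.\<close>

lemma sum_mult_lookup_pushforward:
  fixes a :: "'z \<Rightarrow>\<^sub>0 'c::semiring_0"
  assumes "finite X" "finite Z" "Poly_Mapping.keys a \<subseteq> Z" "g ` Z \<subseteq> X"
  shows "(\<Sum>x\<in>X. F x * Poly_Mapping.lookup (pushforward g a) x)
       = (\<Sum>z\<in>Z. F (g z) * Poly_Mapping.lookup a z)"
proof (induction a rule: poly_mapping_additive_induct)
  case (single k c)
  then have "k \<in> Z" "g k \<in> X" using assms by auto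
  then show ?case using assms(1,2)
    by (simp add: lookup_single when_def if_distrib[of "\<lambda>c. _ * c"] sum.delta cong: if_cong)
qed (simp_all add: pushforward_add lookup_add distrib_left sum.distrib)

section \<open>Polynomial rings\<close>

text \<open>Negatives come for free: the negative of \<open>a\<close> is the multiple of
  \<open>a\<close> by minus one. Commutativity supplies the multiplication on the other
  side.\<close>

lemma (in cring) ideal_of_closed:
  assumes "K \<subseteq> carrier R" "\<zero> \<in> K" "\<And>a b. a \<in> K \<Longrightarrow> b \<in> K \<Longrightarrow> a \<oplus> b \<in> K"
    and m: "\<And>a x. a \<in> K \<Longrightarrow> x \<in> carrier R \<Longrightarrow> x \<otimes> a \<in> K"
  shows "ideal K R"
proof (rule idealI[OF ring_axioms])
  have "\<ominus> a \<in> K" if "a \<in> K" for a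
    using m[OF that, of "\<ominus> \<one>"] that assms(1) by (simp add: l_minus subsetD)
  with assms show "subgroup K (add_monoid R)"
    by (intro subgroup.intro) (auto simp: a_inv_def)
qed (use assms m_comm in \<open>auto simp: subset_iff\<close>)

lemma keys_mult_subset:
  fixes p q :: "'x mpoly"
  assumes "c \<in> Poly_Mapping.keys (p * q)"
    and "\<And>a. a \<in> Poly_Mapping.keys p \<Longrightarrow> Poly_Mapping.keys a \<subseteq> X"
    and "\<And>a. a \<in> Poly_Mapping.keys q \<Longrightarrow> Poly_Mapping.keys a \<subseteq> X"
  shows "Poly_Mapping.keys c \<subseteq> X"
proof -
  obtain a b where "c = a + b" "a \<in> Poly_Mapping.keys p" "b \<in> Poly_Mapping.keys q"
    using subsetD[OF keys_mult assms(1)] by auto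
  then show ?thesis using keys_add[of a b] assms(2)[of a] assms(3)[of b] by auto
qed

lemma mpoly_ring_simps [simp]:
  "mult (mpoly_ring X) = (*)" "one (mpoly_ring X) = 1" "zero (mpoly_ring X) = 0"
  "add (mpoly_ring X) = (+)"
  by (simp_all add: mpoly_ring_def)

lemma mem_carrier_mpoly_ring:
  "p \<in> carrier (mpoly_ring X) \<longleftrightarrow> (\<forall>a\<in>Poly_Mapping.keys p. Poly_Mapping.keys a \<subseteq> X)"
  by (simp add: mpoly_ring_def)

lemma cring_mpoly_ring: "cring (mpoly_ring X)"
proof (rule cringI)
  show "abelian_group (mpoly_ring X)"
  proof (rule abelian_groupI)
    fix p q assume *: "p \<in> carrier (mpoly_ring X)" "q \<in> carrier (mpoly_ring X)"
    then show "p \<oplus>\<^bsub>mpoly_ring X\<^esub> q \<in> carrier (mpoly_ring X)"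
      using keys_add[of p q] by (auto simp: mem_carrier_mpoly_ring)
    show "\<exists>y\<in>carrier (mpoly_ring X). y \<oplus>\<^bsub>mpoly_ring X\<^esub> p = \<zero>\<^bsub>mpoly_ring X\<^esub>"
      using * by (intro bexI[of _ "- p"]) (auto simp: mem_carrier_mpoly_ring in_keys_iff)
  qed (auto simp: mem_carrier_mpoly_ring add_ac)
  show "comm_monoid (mpoly_ring X)"
  proof (rule comm_monoidI)
    fix p q assume *: "p \<in> carrier (mpoly_ring X)" "q \<in> carrier (mpoly_ring X)"
    then show "p \<otimes>\<^bsub>mpoly_ring X\<^esub> q \<in> carrier (mpoly_ring X)"
      using keys_mult_subset[of _ p q X] by (auto simp: mem_carrier_mpoly_ring)
  qed (auto simp: mem_carrier_mpoly_ring mult_ac)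
qed (simp add: distrib_right)

lemma single_mem_mpoly_ring:
  "Poly_Mapping.keys a \<subseteq> X \<Longrightarrow> Poly_Mapping.single a c \<in> carrier (mpoly_ring X)"
  by (simp add: mem_carrier_mpoly_ring)

lemma mpoly_ring_sum_mem:
  assumes "ideal I (mpoly_ring X)" "\<And>i. i \<in> K \<Longrightarrow> F i \<in> I"
  shows "sum F K \<in> I"
proof -
  interpret ideal I "mpoly_ring X" by fact
  have "0 \<in> I" using additive_subgroup.zero_closed[OF additive_subgroup_axioms] by simp
  moreover have "a + b \<in> I" if "a \<in> I" "b \<in> I" for a b
    using additive_subgroup.a_closed[OF additive_subgroup_axioms that] by simp
  ultimately show ?thesis using assms(2)
    by (induction K rule: infinite_finite_induct) simp_all
qed

lemma mpoly_ring_minus: "p \<in> carrier (mpoly_ring X) \<Longrightarrow> q \<in> carrier (mpoly_ring X) \<Longrightarrow>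
  p - q \<in> carrier (mpoly_ring X)"
  using keys_diff[of p q] by (auto simp: mem_carrier_mpoly_ring)

text \<open>This is the kernel of a ring homomorphism into the monoid algebra of the
  weights.\<close>

lemma ideal_pushforward_kernel:
  fixes w :: "('x \<Rightarrow>\<^sub>0 nat) \<Rightarrow> 'w::comm_monoid_add"
  assumes "\<And>a b. w (a + b) = w a + w b"
  shows "ideal {p \<in> carrier (mpoly_ring X). pushforward w p = 0} (mpoly_ring X)"
proof -
  interpret cring "mpoly_ring X" by (rule cring_mpoly_ring)
  show ?thesis
    by (rule ideal_of_closed)
      (use a_closed m_closed zero_closed in \<open>auto simp: pushforward_add pushforward_mult assms\<close>)
qed

text \<open>
  Every toric ideal is the kernel of a monomial map. For the nontrivial inclusion choose a
  representative \<open>\<rho> a\<close> of each fibre of \<open>w\<close>; replacing \<open>a\<close> by \<open>\<rho> a\<close> changes a polynomial by an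
  element of the toric ideal, and annihilates it if it lies in the kernel.
\<close>

lemma toric_ideal_eq_kernel:
  fixes w :: "('x \<Rightarrow>\<^sub>0 nat) \<Rightarrow> 'w::comm_monoid_add"
  assumes add: "\<And>a b. w (a + b) = w a + w b"
    and w: "\<And>a b. Poly_Mapping.keys a \<subseteq> X \<Longrightarrow> Poly_Mapping.keys b \<subseteq> X \<Longrightarrow> w a = w b \<longleftrightarrow>
      (\<forall>i<n. (\<Sum>x\<in>X. M i x * Poly_Mapping.lookup a x) = (\<Sum>x\<in>X. M i x * Poly_Mapping.lookup b x))"
  shows "toric_ideal n X M = {p \<in> carrier (mpoly_ring X). pushforward w p = 0}"
proof
  interpret cring "mpoly_ring X" by (rule cring_mpoly_ring)
  let ?G = "{monomial a - monomial b | a b. Poly_Mapping.keys a \<subseteq> X \<and> Poly_Mapping.keys b \<subseteq> X \<and>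
        (\<forall>i<n. (\<Sum>x\<in>X. M i x * Poly_Mapping.lookup a x) = (\<Sum>x\<in>X. M i x * Poly_Mapping.lookup b x))}"
  have G: "?G \<subseteq> carrier (mpoly_ring X)"
    by (auto simp: monomial_def intro!: mpoly_ring_minus single_mem_mpoly_ring)
  show "toric_ideal n X M \<subseteq> {p \<in> carrier (mpoly_ring X). pushforward w p = 0}"
    unfolding toric_ideal_def
  proof (rule genideal_minimal[OF ideal_pushforward_kernel[OF add]])
    show "?G \<subseteq> {p \<in> carrier (mpoly_ring X). pushforward w p = 0}"
      using G by (auto simp: monomial_def pushforward_diff w[symmetric])
  qed
  have I: "ideal (toric_ideal n X M) (mpoly_ring X)"
    unfolding toric_ideal_def using G by (rule genideal_ideal)
  show "{p \<in> carrier (mpoly_ring X). pushforward w p = 0} \<subseteq> toric_ideal n X M"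
  proof
    fix p assume "p \<in> {p \<in> carrier (mpoly_ring X). pushforward w p = 0}"
    then have p: "\<And>a. a \<in> Poly_Mapping.keys p \<Longrightarrow> Poly_Mapping.keys a \<subseteq> X" "pushforward w p = 0"
      by (auto simp: mem_carrier_mpoly_ring)
    \<comment> \<open>The choice is restricted to exponent vectors supported in \<open>X\<close>, so
      that the difference of a monomial and its representative is a generator of the toric
      ideal.\<close>
    define rep where "rep s = (SOME b. Poly_Mapping.keys b \<subseteq> X \<and> w b = s)" for s
    have rep: "Poly_Mapping.keys (rep (w a)) \<subseteq> X \<and> w (rep (w a)) = w a" if "Poly_Mapping.keys a \<subseteq> X" for a
      unfolding rep_def by (rule someI[of _ a]) (use that in auto)
    have "pushforward (\<lambda>a. rep (w a)) p = 0"
      using pushforward_pushforward[of rep w p] p(2) by simp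
    \<comment> \<open>The subtracted sum is the push-forward just shown to vanish; it is inserted so
      that \<open>p\<close> becomes a combination of differences of monomials of equal
      weight.\<close>
    then have "p = (\<Sum>a\<in>Poly_Mapping.keys p. Poly_Mapping.single a (Poly_Mapping.lookup p a))
        - (\<Sum>a\<in>Poly_Mapping.keys p. Poly_Mapping.single (rep (w a)) (Poly_Mapping.lookup p a))"
      by (simp add: poly_mapping_expand pushforward_def)
    also have "\<dots> = (\<Sum>a\<in>Poly_Mapping.keys p. const (Poly_Mapping.lookup p a) * (monomial a - monomial (rep (w a))))"
      by (simp add: sum_subtractf[symmetric] const_def monomial_def right_diff_distrib mult_single)
    also have "\<dots> \<in> toric_ideal n X M"
    proof (rule mpoly_ring_sum_mem[OF I])
      fix a assume "a \<in> Poly_Mapping.keys p"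
      then have a: "Poly_Mapping.keys a \<subseteq> X" by (rule p)
      have "monomial a - monomial (rep (w a)) \<in> ?G"
        using a rep[OF a] w[OF a, of "rep (w a)"] by auto
      then have "monomial a - monomial (rep (w a)) \<in> toric_ideal n X M"
        unfolding toric_ideal_def using genideal_self[OF G] by blast
      moreover have "const (Poly_Mapping.lookup p a) \<in> carrier (mpoly_ring X)"
        unfolding const_def by (rule single_mem_mpoly_ring) simp
      ultimately show "const (Poly_Mapping.lookup p a) * (monomial a - monomial (rep (w a))) \<in> toric_ideal n X M"
        using ideal.I_l_closed[OF I] by simp
    qed
    finally show "p \<in> toric_ideal n X M" .
  qed
qed

section \<open>Tensor products\<close>

lemma free_algebra_simps [simp]:
  "mult (free_algebra A B) = free_mult A B" "zero (free_algebra A B) = 0"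
  "one (free_algebra A B) = Poly_Mapping.single (\<one>\<^bsub>A\<^esub>, \<one>\<^bsub>B\<^esub>) 1"
  "add (free_algebra A B) = (+)"
  by (simp_all add: free_algebra_def)

lemma mem_carrier_free_algebra:
  "f \<in> carrier (free_algebra A B) \<longleftrightarrow> Poly_Mapping.keys f \<subseteq> carrier A \<times> carrier B"
  by (simp add: free_algebra_def)

lemma free_mult_zero [simp]: "free_mult A B 0 f = 0" "free_mult A B f 0 = 0"
  by (simp_all add: free_mult_def)

lemma free_mult_single [simp]:
  "free_mult A B (Poly_Mapping.single p c) (Poly_Mapping.single q d) =
     Poly_Mapping.single (fst p \<otimes>\<^bsub>A\<^esub> fst q, snd p \<otimes>\<^bsub>B\<^esub> snd q) (c * d)"
  by (simp add: free_mult_def)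

lemma free_mult_add_left: "free_mult A B (f + g) h = free_mult A B f h + free_mult A B g h"
  unfolding free_mult_def
  by (rule setsum_keys_plus_distrib) (simp_all add: distrib_right single_add sum.distrib)

lemma free_mult_add_right: "free_mult A B h (f + g) = free_mult A B h f + free_mult A B h g"
  \<comment> \<open>The swap brings the sum over the keys of the varying factor to the outside,
    where additivity over keys applies.\<close>
  unfolding free_mult_def sum.swap[where A = "Poly_Mapping.keys h"]
  by (rule setsum_keys_plus_distrib) (simp_all add: distrib_left single_add sum.distrib)

text \<open>The product is bilinear, so each monoid law may be checked on basis vectors by additive
  induction in every argument. There it is the corresponding law of \<open>A\<close> and
  \<open>B\<close>, component by component.\<close>

lemma cring_free_algebra:
  assumes "cring A" "cring B"
  shows "cring (free_algebra A B)"
proof -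
  interpret A: cring A by fact
  interpret B: cring B by fact
  let ?F = "free_algebra A B"
  show ?thesis
  proof (rule cringI)
    show "abelian_group ?F"
    proof (rule abelian_groupI)
      fix f g assume *: "f \<in> carrier ?F" "g \<in> carrier ?F"
      then show "f \<oplus>\<^bsub>?F\<^esub> g \<in> carrier ?F"
        using keys_add[of f g] by (auto simp: mem_carrier_free_algebra)
      show "\<exists>h\<in>carrier ?F. h \<oplus>\<^bsub>?F\<^esub> f = \<zero>\<^bsub>?F\<^esub>"
        using * by (intro bexI[of _ "- f"]) (auto simp: mem_carrier_free_algebra in_keys_iff)
    qed (auto simp: mem_carrier_free_algebra add_ac)
    show "comm_monoid ?F"
    proof (rule comm_monoidI)
      fix f g assume "f \<in> carrier ?F" "g \<in> carrier ?F"
      then have f: "Poly_Mapping.keys f \<subseteq> carrier A \<times> carrier B"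
        and g: "Poly_Mapping.keys g \<subseteq> carrier A \<times> carrier B"
        by (simp_all add: mem_carrier_free_algebra)
      have "Poly_Mapping.keys (free_mult A B f g) \<subseteq> carrier A \<times> carrier B"
        unfolding free_mult_def
        using f g by (intro order_trans[OF keys_sum] UN_least) (auto dest!: subsetD)
      then show "f \<otimes>\<^bsub>?F\<^esub> g \<in> carrier ?F" by (simp add: mem_carrier_free_algebra)
      have "free_mult A B f g = free_mult A B g f"
      proof (induction f rule: poly_mapping_additive_induct)
        case (single k c)
        with f have k: "fst k \<in> carrier A" "snd k \<in> carrier B" by auto
        show ?case
        proof (induction g rule: poly_mapping_additive_induct)
          case (single l d)
          with g have "fst l \<in> carrier A" "snd l \<in> carrier B" by auto
          with k show ?case
            by (simp add: mult.commute A.m_comm[of "fst k"] B.m_comm[of "snd k"])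
        qed (simp_all add: free_mult_add_left free_mult_add_right)
      qed (simp_all add: free_mult_add_left free_mult_add_right)
      then show "f \<otimes>\<^bsub>?F\<^esub> g = g \<otimes>\<^bsub>?F\<^esub> f" by simp
      fix h assume "h \<in> carrier ?F"
      then have h: "Poly_Mapping.keys h \<subseteq> carrier A \<times> carrier B"
        by (simp add: mem_carrier_free_algebra)
      have "free_mult A B (free_mult A B f g) h = free_mult A B f (free_mult A B g h)"
      proof (induction f rule: poly_mapping_additive_induct)
        case (single k c)
        with f have k: "fst k \<in> carrier A" "snd k \<in> carrier B" by auto
        show ?case
        proof (induction g rule: poly_mapping_additive_induct)
          case (single l d)
          with g have l: "fst l \<in> carrier A" "snd l \<in> carrier B" by auto
          show ?case
          proof (induction h rule: poly_mapping_additive_induct)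
            case (single n e)
            with h have "fst n \<in> carrier A" "snd n \<in> carrier B" by auto
            with k l show ?case
              by (simp add: A.m_assoc B.m_assoc mult.assoc)
          qed (simp_all add: free_mult_add_left free_mult_add_right)
        qed (simp_all add: free_mult_add_left free_mult_add_right)
      qed (simp_all add: free_mult_add_left free_mult_add_right)
      then show "f \<otimes>\<^bsub>?F\<^esub> g \<otimes>\<^bsub>?F\<^esub> h = f \<otimes>\<^bsub>?F\<^esub> (g \<otimes>\<^bsub>?F\<^esub> h)" by simp
    next
      fix f assume "f \<in> carrier ?F"
      then have f: "Poly_Mapping.keys f \<subseteq> carrier A \<times> carrier B"
        by (simp add: mem_carrier_free_algebra)
      have "free_mult A B (Poly_Mapping.single (\<one>\<^bsub>A\<^esub>, \<one>\<^bsub>B\<^esub>) 1) f = f"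
      proof (induction f rule: poly_mapping_additive_induct)
        case (single k c)
        with f have "fst k \<in> carrier A" "snd k \<in> carrier B" by auto
        then show ?case by simp
      qed (simp_all add: free_mult_add_right)
      then show "\<one>\<^bsub>?F\<^esub> \<otimes>\<^bsub>?F\<^esub> f = f" by simp
    qed (simp add: mem_carrier_free_algebra)
  qed (simp add: free_mult_add_left)
qed

section \<open>Quotients of a polynomial ring by the kernel of a monomial map\<close>

locale monomial_quotient =
  fixes X :: "'x set" and I :: "'x mpoly set" and w :: "('x \<Rightarrow>\<^sub>0 nat) \<Rightarrow> 'w::comm_monoid_add"
  assumes w_add: "w (a + b) = w a + w b" and w_zero: "w 0 = 0"
    and I_eq: "I = {p \<in> carrier (mpoly_ring X). pushforward w p = 0}"
begin

lemma ideal_I: "ideal I (mpoly_ring X)"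
  unfolding I_eq by (rule ideal_pushforward_kernel[OF w_add])

abbreviation quotient :: "'x mpoly set ring" where
  "quotient \<equiv> mpoly_ring X Quot I"

lemma cring_quotient: "cring quotient"
  by (rule ideal.quotient_is_cring[OF ideal_I cring_mpoly_ring])

lemma quot_class_closed: "p \<in> carrier (mpoly_ring X) \<Longrightarrow> quot_class X I p \<in> carrier quotient"
  unfolding quot_class_def by (rule ring_hom_closed[OF ideal.rcos_ring_hom[OF ideal_I]])

lemma quot_class_mult:
  "p \<in> carrier (mpoly_ring X) \<Longrightarrow> q \<in> carrier (mpoly_ring X) \<Longrightarrow>
     quot_class X I (p * q) = quot_class X I p \<otimes>\<^bsub>quotient\<^esub> quot_class X I q"
  unfolding quot_class_def using ring_hom_mult[OF ideal.rcos_ring_hom[OF ideal_I]] by fastforce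

lemma quot_class_add:
  "p \<in> carrier (mpoly_ring X) \<Longrightarrow> q \<in> carrier (mpoly_ring X) \<Longrightarrow>
     quot_class X I (p + q) = quot_class X I p \<oplus>\<^bsub>quotient\<^esub> quot_class X I q"
  unfolding quot_class_def using ring_hom_add[OF ideal.rcos_ring_hom[OF ideal_I]] by fastforce

lemma quot_class_one: "\<one>\<^bsub>quotient\<^esub> = quot_class X I 1"
  by (simp add: quot_class_def FactRing_def)

lemma quotient_cases:
  assumes "P \<in> carrier quotient"
  obtains p where "p \<in> carrier (mpoly_ring X)" "P = quot_class X I p"
  using assms by (auto simp: FactRing_def A_RCOSETS_def' quot_class_def)

lemma quot_class_eqI:
  assumes "p \<in> carrier (mpoly_ring X)" "q \<in> carrier (mpoly_ring X)"
    and "pushforward w p = pushforward w q"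
  shows "quot_class X I p = quot_class X I q"
proof -
  have "p - q \<in> I" using assms by (simp add: I_eq mpoly_ring_minus pushforward_diff)
  interpret ideal I "mpoly_ring X" by (rule ideal_I)
  from \<open>p - q \<in> I\<close> have "p \<in> I +>\<^bsub>mpoly_ring X\<^esub> q"
    unfolding a_r_coset_def' by (intro UN_I[of "p - q"]) simp_all
  then show ?thesis
    unfolding quot_class_def by (rule a_repr_independence[symmetric, OF _ assms(2) a_subgroup])
qed

text \<open>The map induced by the monomial map on the quotient ring. The choice of a member of the
  coset is harmless, because two members differ by an element of \<open>I\<close>, which has
  push-forward zero; see \<open>val_quot_class\<close>.\<close>

definition val :: "'x mpoly set \<Rightarrow> 'w \<Rightarrow>\<^sub>0 complex" where
  "val P = pushforward w (SOME p. p \<in> P)"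

lemma val_quot_class:
  assumes "p \<in> carrier (mpoly_ring X)"
  shows "val (quot_class X I p) = pushforward w p"
proof -
  have "0 + p \<in> quot_class X I p"
    unfolding quot_class_def a_r_coset_def' using I_eq by (force simp: mem_carrier_mpoly_ring)
  then have "(SOME q. q \<in> quot_class X I p) \<in> quot_class X I p" by (rule someI)
  then obtain i where "i \<in> I" "(SOME q. q \<in> quot_class X I p) = i + p"
    by (auto simp: quot_class_def a_r_coset_def')
  then show ?thesis by (simp add: val_def I_eq pushforward_add)
qed

lemma val_add:
  assumes "P \<in> carrier quotient" "Q \<in> carrier quotient"
  shows "val (P \<oplus>\<^bsub>quotient\<^esub> Q) = val P + val Q"
proof -
  interpret R: cring "mpoly_ring X" by (rule cring_mpoly_ring)
  obtain p q where p: "p \<in> carrier (mpoly_ring X)" "P = quot_class X I p"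
    and q: "q \<in> carrier (mpoly_ring X)" "Q = quot_class X I q"
    using assms by (elim quotient_cases)
  then show ?thesis
    using R.a_closed[OF p(1) q(1)] by (simp add: val_quot_class pushforward_add flip: quot_class_add)
qed

lemma val_mult:
  assumes "P \<in> carrier quotient" "Q \<in> carrier quotient"
  shows "val (P \<otimes>\<^bsub>quotient\<^esub> Q) = val P * val Q"
proof -
  interpret R: cring "mpoly_ring X" by (rule cring_mpoly_ring)
  obtain p q where p: "p \<in> carrier (mpoly_ring X)" "P = quot_class X I p"
    and q: "q \<in> carrier (mpoly_ring X)" "Q = quot_class X I q"
    using assms by (elim quotient_cases)
  then show ?thesis
    using R.m_closed[OF p(1) q(1)] by (simp add: val_quot_class pushforward_mult w_add flip: quot_class_mult)
qed

lemma const_closed: "const c \<in> carrier (mpoly_ring X)"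
  unfolding const_def by (rule single_mem_mpoly_ring) simp

text \<open>Here \<open>w_zero\<close> enters: constants have exponent 0 and must go to constants of
  the monoid algebra, which makes \<open>val\<close> linear over the complex numbers.\<close>

lemma val_const_mult:
  "P \<in> carrier quotient \<Longrightarrow>
     val (quot_class X I (const c) \<otimes>\<^bsub>quotient\<^esub> P) = Poly_Mapping.single 0 c * val P"
  by (simp add: val_mult quot_class_closed const_closed val_quot_class)
    (simp add: const_def w_zero)

end

section \<open>The tensor product of two such quotients\<close>

text \<open>Both weights live in one monoid, so that the two monomial maps can be multiplied. The
  assumption \<open>independent\<close> says that a sum of weights determines both summands; it is
  what makes this product lose no information on tensors of monomials.\<close>

locale monomial_tensor =
  B: monomial_quotient X I wB + C: monomial_quotient Y J wC
  for X :: "'x set" and I and Y :: "'y set" and J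
    and wB :: "('x \<Rightarrow>\<^sub>0 nat) \<Rightarrow> 'w::comm_monoid_add" and wC :: "('y \<Rightarrow>\<^sub>0 nat) \<Rightarrow> 'w" +
  assumes independent: "wB a + wC b = wB a' + wC b' \<Longrightarrow> wB a = wB a' \<and> wC b = wC b'"
begin

abbreviation free :: "('x mpoly set \<times> 'y mpoly set \<Rightarrow>\<^sub>0 complex) ring" where
  "free \<equiv> free_algebra B.quotient C.quotient"

abbreviation relations :: "('x mpoly set \<times> 'y mpoly set \<Rightarrow>\<^sub>0 complex) set" where
  "relations \<equiv> bilinear_relations B.quotient (\<lambda>c. quot_class X I (const c))
     C.quotient (\<lambda>c. quot_class Y J (const c))"

abbreviation kernel_ideal :: "('x mpoly set \<times> 'y mpoly set \<Rightarrow>\<^sub>0 complex) set" where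
  "kernel_ideal \<equiv> tensor_ideal B.quotient (\<lambda>c. quot_class X I (const c))
     C.quotient (\<lambda>c. quot_class Y J (const c))"

text \<open>The linear extension of \<open>(P, Q)\<close> \<mapsto> \<open>val P * val Q\<close> to
  the free vector space on pairs, before the bilinearity relations are divided out. A scalar
  \<open>c\<close> acts as the constant \<open>single 0 c\<close> of the monoid algebra.\<close>

definition theta :: "('x mpoly set \<times> 'y mpoly set \<Rightarrow>\<^sub>0 complex) \<Rightarrow> 'w \<Rightarrow>\<^sub>0 complex" where
  "theta f = (\<Sum>k\<in>Poly_Mapping.keys f.
     Poly_Mapping.single 0 (Poly_Mapping.lookup f k) * (B.val (fst k) * C.val (snd k)))"

lemma cring_free: "cring free"
  by (rule cring_free_algebra[OF B.cring_quotient C.cring_quotient])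

lemma theta_zero [simp]: "theta 0 = 0"
  by (simp add: theta_def)

lemma theta_single [simp]:
  "theta (Poly_Mapping.single k c) = Poly_Mapping.single 0 c * (B.val (fst k) * C.val (snd k))"
  by (simp add: theta_def)

lemma theta_add: "theta (f + g) = theta f + theta g"
  unfolding theta_def by (rule setsum_keys_plus_distrib) (simp_all add: single_add distrib_right)

lemma theta_diff: "theta (f - g) = theta f - theta g"
  using theta_add[of "f - g" g] by (simp add: algebra_simps)

lemma theta_mult:
  assumes "f \<in> carrier free" "g \<in> carrier free"
  shows "theta (f \<otimes>\<^bsub>free\<^esub> g) = theta f * theta g"
proof -
  have "theta (free_mult B.quotient C.quotient f g) = theta f * theta g"
  proof (induction f rule: poly_mapping_additive_induct)
    case (single k c)
    with assms have k: "fst k \<in> carrier B.quotient" "snd k \<in> carrier C.quotient"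
      by (auto simp: mem_carrier_free_algebra)
    show ?case
    proof (induction g rule: poly_mapping_additive_induct)
      case (single l d)
      with assms have l: "fst l \<in> carrier B.quotient" "snd l \<in> carrier C.quotient"
        by (auto simp: mem_carrier_free_algebra)
      have "Poly_Mapping.single 0 (c * d) = Poly_Mapping.single (0::'w) c * Poly_Mapping.single 0 d"
        by (simp add: mult_single)
      with k l show ?case by (simp add: B.val_mult C.val_mult mult_ac)
    qed (simp_all add: free_mult_add_right theta_add distrib_left)
  qed (simp_all add: free_mult_add_left theta_add distrib_right)
  then show ?thesis by simp
qed

lemma single_mem_free:
  "P \<in> carrier B.quotient \<Longrightarrow> Q \<in> carrier C.quotient \<Longrightarrow> Poly_Mapping.single (P, Q) c \<in> carrier free"
  by (simp add: mem_carrier_free_algebra)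

lemma minus_mem_free:
  "f \<in> carrier free \<Longrightarrow> g \<in> carrier free \<Longrightarrow> f - g \<in> carrier free"
  using keys_diff[of f g] by (auto simp: mem_carrier_free_algebra)

lemma relations_subset: "relations \<subseteq> carrier free"
proof -
  interpret QB: cring B.quotient by (rule B.cring_quotient)
  interpret QC: cring C.quotient by (rule C.cring_quotient)
  show ?thesis
    unfolding bilinear_relations_def
    using B.quot_class_closed[OF B.const_closed] C.quot_class_closed[OF C.const_closed]
    by (auto intro!: minus_mem_free single_mem_free QB.a_closed QC.a_closed QB.m_closed QC.m_closed)
qed

lemma theta_relations: "f \<in> relations \<Longrightarrow> theta f = 0"
  unfolding bilinear_relations_def
  by (auto simp: theta_diff B.val_add C.val_add B.val_const_mult C.val_const_mult distrib_left distrib_right mult_ac)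

lemma ideal_kernel_ideal: "ideal kernel_ideal free"
proof -
  interpret F: cring free by (rule cring_free)
  show ?thesis unfolding tensor_ideal_def by (rule F.genideal_ideal[OF relations_subset])
qed

text \<open>The zero set of \<open>theta\<close> is an ideal because \<open>theta\<close> is
  multiplicative, and it contains the bilinear relations, hence everything they generate. This is
  the tool for showing that an element of the tensor product is nonzero.\<close>

lemma theta_kernel_ideal: "f \<in> kernel_ideal \<Longrightarrow> theta f = 0"
proof -
  interpret F: cring free by (rule cring_free)
  have "ideal {f \<in> carrier free. theta f = 0} free"
    by (rule F.ideal_of_closed)
      (use F.a_closed F.m_closed F.zero_closed theta_mult in \<open>auto simp: theta_add\<close>)
  then have "kernel_ideal \<subseteq> {f \<in> carrier free. theta f = 0}"
    unfolding tensor_ideal_def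
    using relations_subset theta_relations by (intro F.genideal_minimal) auto
  then show "f \<in> kernel_ideal \<Longrightarrow> theta f = 0" by auto
qed

lemma relation_scalar:
  assumes "P \<in> carrier B.quotient" "Q \<in> carrier C.quotient"
  shows "Poly_Mapping.single (quot_class X I (const c) \<otimes>\<^bsub>B.quotient\<^esub> P, Q) 1 - Poly_Mapping.single (P, Q) c
    \<in> kernel_ideal"
proof -
  interpret F: cring free by (rule cring_free)
  have "Poly_Mapping.single (quot_class X I (const c) \<otimes>\<^bsub>B.quotient\<^esub> P, Q) 1 - Poly_Mapping.single (P, Q) c
    \<in> relations"
    unfolding bilinear_relations_def using assms by blast
  then show ?thesis unfolding tensor_ideal_def using F.genideal_self[OF relations_subset] by blast
qed

lemma quot_tensor_eq: "quot_tensor X I Y J = free Quot kernel_ideal"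
  by (simp add: quot_tensor_def tensor_product_def)

lemma quot_pure_eq:
  "quot_pure X I Y J p q =
     kernel_ideal +>\<^bsub>free\<^esub> Poly_Mapping.single (quot_class X I p, quot_class Y J q) 1"
  by (simp add: quot_pure_def pure_tensor_def)

lemma cring_quot_tensor: "cring (quot_tensor X I Y J)"
  unfolding quot_tensor_eq by (rule ideal.quotient_is_cring[OF ideal_kernel_ideal cring_free])

lemma coset_closed: "f \<in> carrier free \<Longrightarrow> kernel_ideal +>\<^bsub>free\<^esub> f \<in> carrier (quot_tensor X I Y J)"
  unfolding quot_tensor_eq by (rule ring_hom_closed[OF ideal.rcos_ring_hom[OF ideal_kernel_ideal]])

lemma coset_add:
  "f \<in> carrier free \<Longrightarrow> g \<in> carrier free \<Longrightarrow>
     (kernel_ideal +>\<^bsub>free\<^esub> f) \<oplus>\<^bsub>quot_tensor X I Y J\<^esub> (kernel_ideal +>\<^bsub>free\<^esub> g)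
       = kernel_ideal +>\<^bsub>free\<^esub> (f + g)"
  unfolding quot_tensor_eq using ring_hom_add[OF ideal.rcos_ring_hom[OF ideal_kernel_ideal]] by fastforce

lemma coset_zero: "\<zero>\<^bsub>quot_tensor X I Y J\<^esub> = kernel_ideal +>\<^bsub>free\<^esub> 0"
proof -
  interpret K: ideal kernel_ideal free by (rule ideal_kernel_ideal)
  show ?thesis
    using K.a_coset_add_zero[OF K.a_subset] by (simp add: quot_tensor_eq FactRing_def[of free])
qed

lemma coset_eq_zero_iff:
  assumes "f \<in> carrier free"
  shows "kernel_ideal +>\<^bsub>free\<^esub> f = \<zero>\<^bsub>quot_tensor X I Y J\<^esub> \<longleftrightarrow> f \<in> kernel_ideal"
proof -
  interpret K: ideal kernel_ideal free by (rule ideal_kernel_ideal)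
  have "\<zero>\<^bsub>quot_tensor X I Y J\<^esub> = kernel_ideal"
    by (simp add: quot_tensor_eq FactRing_def[of free])
  then show ?thesis
    using K.rcos_const_imp_mem[OF assms] K.a_coset_join2[OF assms K.a_subgroup] by auto
qed

lemma quot_pure_closed:
  "p \<in> carrier (mpoly_ring X) \<Longrightarrow> q \<in> carrier (mpoly_ring Y) \<Longrightarrow>
     quot_pure X I Y J p q \<in> carrier (quot_tensor X I Y J)"
  unfolding quot_pure_eq
  by (intro coset_closed single_mem_free B.quot_class_closed C.quot_class_closed)

lemma quot_pure_mult:
  assumes "p \<in> carrier (mpoly_ring X)" "q \<in> carrier (mpoly_ring Y)"
    and "p' \<in> carrier (mpoly_ring X)" "q' \<in> carrier (mpoly_ring Y)"
  shows "quot_pure X I Y J p q \<otimes>\<^bsub>quot_tensor X I Y J\<^esub> quot_pure X I Y J p' q'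
    = quot_pure X I Y J (p * p') (q * q')"
  unfolding quot_pure_eq quot_tensor_eq
  by (subst ring_hom_mult[OF ideal.rcos_ring_hom[OF ideal_kernel_ideal], symmetric])
    (use assms in \<open>simp_all add: single_mem_free B.quot_class_closed C.quot_class_closed
       B.quot_class_mult C.quot_class_mult\<close>)

lemma quot_pure_one: "\<one>\<^bsub>quot_tensor X I Y J\<^esub> = quot_pure X I Y J 1 1"
  unfolding quot_pure_eq quot_tensor_eq
  by (simp add: FactRing_def[of free] B.quot_class_one C.quot_class_one)

lemma quot_pure_power:
  assumes "p \<in> carrier (mpoly_ring X)" "q \<in> carrier (mpoly_ring Y)"
  shows "quot_pure X I Y J p q [^]\<^bsub>quot_tensor X I Y J\<^esub> n = quot_pure X I Y J (p ^ n) (q ^ n)"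
proof -
  interpret T: cring "quot_tensor X I Y J" by (rule cring_quot_tensor)
  interpret RX: cring "mpoly_ring X" by (rule cring_mpoly_ring)
  interpret RY: cring "mpoly_ring Y" by (rule cring_mpoly_ring)
  have closed: "p ^ n \<in> carrier (mpoly_ring X) \<and> q ^ n \<in> carrier (mpoly_ring Y)" for n
  proof (induction n)
    case 0
    then show ?case using RX.one_closed RY.one_closed by simp
  next
    case (Suc n)
    then show ?case using RX.m_closed[of p "p ^ n"] RY.m_closed[of q "q ^ n"] assms by simp
  qed
  show ?thesis
  proof (induction n)
    case 0
    then show ?case by (simp add: quot_pure_one)
  next
    case (Suc n)
    then show ?case
      using closed[of n] assms by (simp add: quot_pure_mult power_Suc2 del: power_Suc)
  qed
qed

text \<open>The scalar is first multiplied into the left factor and then moved out by a bilinearity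
  relation, where it becomes the coefficient of a basis vector of the free algebra. In this way the
  terms of \<open>mpoly_eval\<close> become cosets of explicit vectors.\<close>

lemma const_mult_quot_pure:
  assumes "p \<in> carrier (mpoly_ring X)" "q \<in> carrier (mpoly_ring Y)"
  shows "quot_pure X I Y J (const c) 1 \<otimes>\<^bsub>quot_tensor X I Y J\<^esub> quot_pure X I Y J p q
    = kernel_ideal +>\<^bsub>free\<^esub> Poly_Mapping.single (quot_class X I p, quot_class Y J q) c"
proof -
  interpret K: ideal kernel_ideal free by (rule ideal_kernel_ideal)
  interpret QB: cring B.quotient by (rule B.cring_quotient)
  interpret RY: cring "mpoly_ring Y" by (rule cring_mpoly_ring)
  let ?P = "quot_class X I p" and ?Q = "quot_class Y J q"
  let ?c = "quot_class X I (const c)"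
  have cl: "?P \<in> carrier B.quotient" "?Q \<in> carrier C.quotient" "?c \<in> carrier B.quotient"
    using assms by (auto intro: B.quot_class_closed C.quot_class_closed B.const_closed)
  have one: "1 \<in> carrier (mpoly_ring Y)" using RY.one_closed by simp
  let ?f = "Poly_Mapping.single (?c \<otimes>\<^bsub>B.quotient\<^esub> ?P, ?Q) 1 :: _ \<Rightarrow>\<^sub>0 complex"
  let ?g = "Poly_Mapping.single (?P, ?Q) c"
  have "?f \<in> kernel_ideal +>\<^bsub>free\<^esub> ?g"
    unfolding a_r_coset_def'
    by (rule UN_I[OF relation_scalar[OF cl(1,2), of c]]) simp
  then have "kernel_ideal +>\<^bsub>free\<^esub> ?f = kernel_ideal +>\<^bsub>free\<^esub> ?g"
    by (rule K.a_repr_independence[symmetric, OF _ single_mem_free[OF cl(1,2)] K.a_subgroup])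
  then show ?thesis
    using assms by (simp add: quot_pure_mult B.const_closed one) (simp add: quot_pure_eq B.quot_class_mult B.const_closed)
qed

text \<open>The maps \<open>g\<close> and \<open>h\<close> name the two variables whose tensor is
  the image of a variable. Stated for arbitrary \<open>g\<close> and \<open>h\<close>, the
  computation serves both for \<open>psi\<close>, through \<open>split_index\<close>, and for the
  toric fiber product, through the two projections.\<close>

lemma mpoly_eval_eq:
  assumes p: "p \<in> carrier (mpoly_ring Z)" and g: "g ` Z \<subseteq> X" and h: "h ` Z \<subseteq> Y"
  shows "mpoly_eval (quot_tensor X I Y J) (\<lambda>c. quot_pure X I Y J (const c) 1)
      (\<lambda>i. quot_pure X I Y J (var (g i)) (var (h i))) p
    = kernel_ideal +>\<^bsub>free\<^esub> pushforward (\<lambda>a. (quot_class X I (monomial (pushforward g a)),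
        quot_class Y J (monomial (pushforward h a)))) p"
proof -
  let ?T = "quot_tensor X I Y J"
  interpret T: cring ?T by (rule cring_quot_tensor)
  interpret F: cring free by (rule cring_free)
  have var: "var x \<in> carrier (mpoly_ring V)" if "x \<in> V" for x and V :: "'v set"
    using that by (simp add: var_def monomial_def single_mem_mpoly_ring)
  have var_power: "var x ^ n = monomial (Poly_Mapping.single x n)" for x :: 'v and n
    by (induction n) (simp_all add: var_def monomial_def mult_single flip: single_add)
  have mon: "monomial b \<in> carrier (mpoly_ring V)" if "Poly_Mapping.keys b \<subseteq> V" for b and V :: "'v set"
    using that by (simp add: monomial_def single_mem_mpoly_ring)
  have keys: "Poly_Mapping.keys (\<Sum>i\<in>K. Poly_Mapping.single (f i) (Poly_Mapping.lookup a i)) \<subseteq> V"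
    if "f ` K \<subseteq> V" for f :: "'z \<Rightarrow> 'v" and V K and a :: "'z \<Rightarrow>\<^sub>0 nat"
    using that by (intro order_trans[OF keys_sum]) auto
  let ?\<phi> = "\<lambda>i. quot_pure X I Y J (var (g i)) (var (h i))"
  have power: "?\<phi> i [^]\<^bsub>?T\<^esub> n = quot_pure X I Y J (monomial (Poly_Mapping.single (g i) n)) (monomial (Poly_Mapping.single (h i) n))"
    if "i \<in> Z" for i and n :: nat
    using that g h by (simp add: quot_pure_power var subset_iff var_power)
  \<comment> \<open>For \<open>K\<close> the set of keys of \<open>a\<close>, the two sums of
    exponents are the push-forwards of \<open>a\<close> along \<open>g\<close> and
    \<open>h\<close>.\<close>
  have prod: "(\<Otimes>\<^bsub>?T\<^esub>i\<in>K. ?\<phi> i [^]\<^bsub>?T\<^esub> Poly_Mapping.lookup a i)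
      = quot_pure X I Y J (monomial (\<Sum>i\<in>K. Poly_Mapping.single (g i) (Poly_Mapping.lookup a i)))
          (monomial (\<Sum>i\<in>K. Poly_Mapping.single (h i) (Poly_Mapping.lookup a i)))"
    if "finite K" "K \<subseteq> Z" for K a
    using that
  proof induction
    case empty
    show ?case by (simp add: quot_pure_one monomial_def)
  next
    case (insert k K)
    have mult: "monomial b * monomial c = monomial (b + c)" for b c :: "'v \<Rightarrow>\<^sub>0 nat"
      by (simp add: monomial_def mult_single)
    have "?\<phi> i \<in> carrier ?T" if "i \<in> Z" for i
      using that g h by (intro quot_pure_closed var) auto
    then have "(\<lambda>i. ?\<phi> i [^]\<^bsub>?T\<^esub> Poly_Mapping.lookup a i) \<in> K \<rightarrow> carrier ?T"
      "?\<phi> k [^]\<^bsub>?T\<^esub> Poly_Mapping.lookup a k \<in> carrier ?T"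
      using insert.prems by auto
    then have "(\<Otimes>\<^bsub>?T\<^esub>i\<in>insert k K. ?\<phi> i [^]\<^bsub>?T\<^esub> Poly_Mapping.lookup a i)
      = ?\<phi> k [^]\<^bsub>?T\<^esub> Poly_Mapping.lookup a k \<otimes>\<^bsub>?T\<^esub> (\<Otimes>\<^bsub>?T\<^esub>i\<in>K. ?\<phi> i [^]\<^bsub>?T\<^esub> Poly_Mapping.lookup a i)"
      using insert.hyps by (intro T.finprod_insert) auto
    also have "\<dots> = quot_pure X I Y J
       (monomial (Poly_Mapping.single (g k) (Poly_Mapping.lookup a k)))
       (monomial (Poly_Mapping.single (h k) (Poly_Mapping.lookup a k))) \<otimes>\<^bsub>?T\<^esub>
       quot_pure X I Y J (monomial (\<Sum>i\<in>K. Poly_Mapping.single (g i) (Poly_Mapping.lookup a i)))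
          (monomial (\<Sum>i\<in>K. Poly_Mapping.single (h i) (Poly_Mapping.lookup a i)))"
      using insert by (simp add: power)
    also have "\<dots> = quot_pure X I Y J (monomial (\<Sum>i\<in>insert k K. Poly_Mapping.single (g i) (Poly_Mapping.lookup a i)))
          (monomial (\<Sum>i\<in>insert k K. Poly_Mapping.single (h i) (Poly_Mapping.lookup a i)))"
      using insert.hyps insert.prems g h
      by (subst quot_pure_mult) (auto intro!: mon keys simp: mult split: if_splits)
    finally show ?case .
  qed
  have monomials: "monomial (pushforward g a) \<in> carrier (mpoly_ring X)"
    "monomial (pushforward h a) \<in> carrier (mpoly_ring Y)" if "a \<in> Poly_Mapping.keys p" for a
  proof -
    have "Poly_Mapping.keys a \<subseteq> Z" using p that by (simp add: mem_carrier_mpoly_ring)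
    then show "monomial (pushforward g a) \<in> carrier (mpoly_ring X)"
      "monomial (pushforward h a) \<in> carrier (mpoly_ring Y)"
      by (rule mon[OF keys_pushforward_subset[OF _ g]] mon[OF keys_pushforward_subset[OF _ h]])+
  qed
  let ?\<kappa> = "\<lambda>a. (quot_class X I (monomial (pushforward g a)), quot_class Y J (monomial (pushforward h a)))"
  let ?s = "\<lambda>a. Poly_Mapping.single (?\<kappa> a) (Poly_Mapping.lookup p a)"
  have summand: "quot_pure X I Y J (const (Poly_Mapping.lookup p a)) 1 \<otimes>\<^bsub>?T\<^esub>
      (\<Otimes>\<^bsub>?T\<^esub>i\<in>Poly_Mapping.keys a. ?\<phi> i [^]\<^bsub>?T\<^esub> Poly_Mapping.lookup a i) = kernel_ideal +>\<^bsub>free\<^esub> ?s a"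
    if "a \<in> Poly_Mapping.keys p" for a
  proof -
    have "Poly_Mapping.keys a \<subseteq> Z" using p that by (simp add: mem_carrier_mpoly_ring)
    then show ?thesis
      using const_mult_quot_pure[OF monomials[OF that]] by (simp add: prod pushforward_def)
  qed
  have s_closed: "?s a \<in> carrier free" if "a \<in> Poly_Mapping.keys p" for a
    using monomials[OF that] by (intro single_mem_free B.quot_class_closed C.quot_class_closed)
  \<comment> \<open>Membership of the partial sums in the carrier is carried through the same
    induction, since \<open>coset_add\<close> requires it.\<close>
  have "(\<Oplus>\<^bsub>?T\<^esub>a\<in>K. kernel_ideal +>\<^bsub>free\<^esub> ?s a) = kernel_ideal +>\<^bsub>free\<^esub> (\<Sum>a\<in>K. ?s a) \<and> (\<Sum>a\<in>K. ?s a) \<in> carrier free"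
    if "finite K" "K \<subseteq> Poly_Mapping.keys p" for K
    using that
  proof induction
    case empty
    show ?case using coset_zero F.zero_closed by simp
  next
    case (insert a K)
    then have a: "?s a \<in> carrier free" using s_closed by simp
    have "(\<lambda>a. kernel_ideal +>\<^bsub>free\<^esub> ?s a) \<in> K \<rightarrow> carrier ?T"
      using insert.prems s_closed by (intro Pi_I coset_closed) auto
    then show ?case
      using insert a coset_closed[OF a] F.a_closed[OF a]
      by (simp add: T.finsum_insert coset_add)
  qed
  then have "(\<Oplus>\<^bsub>?T\<^esub>a\<in>Poly_Mapping.keys p. kernel_ideal +>\<^bsub>free\<^esub> ?s a)
      = kernel_ideal +>\<^bsub>free\<^esub> pushforward ?\<kappa> p"
    by (simp add: pushforward_def)
  moreover have "mpoly_eval ?T (\<lambda>c. quot_pure X I Y J (const c) 1) ?\<phi> p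
      = (\<Oplus>\<^bsub>?T\<^esub>a\<in>Poly_Mapping.keys p. kernel_ideal +>\<^bsub>free\<^esub> ?s a)"
    unfolding mpoly_eval_def using s_closed
    by (intro T.finsum_cong' refl summand Pi_I coset_closed)
  ultimately show ?thesis by simp
qed

text \<open>If the value is zero, \<open>theta\<close> of the representing vector vanishes, and this
  is the push-forward by total weight. Conversely, by \<open>independent\<close>, monomials of equal
  total weight have equal classes in both quotients, so the representing vector depends only on the
  collected coefficients.\<close>

lemma mpoly_eval_eq_zero_iff:
  assumes p: "p \<in> carrier (mpoly_ring Z)" and g: "g ` Z \<subseteq> X" and h: "h ` Z \<subseteq> Y"
  shows "mpoly_eval (quot_tensor X I Y J) (\<lambda>c. quot_pure X I Y J (const c) 1)
      (\<lambda>i. quot_pure X I Y J (var (g i)) (var (h i))) p = \<zero>\<^bsub>quot_tensor X I Y J\<^esub>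
    \<longleftrightarrow> pushforward (\<lambda>a. wB (pushforward g a) + wC (pushforward h a)) p = 0"
proof -
  let ?\<kappa> = "\<lambda>a. (quot_class X I (monomial (pushforward g a)), quot_class Y J (monomial (pushforward h a)))"
  let ?w = "\<lambda>a. wB (pushforward g a) + wC (pushforward h a)"
  have monomials: "monomial (pushforward g a) \<in> carrier (mpoly_ring X)"
    "monomial (pushforward h a) \<in> carrier (mpoly_ring Y)" if "Poly_Mapping.keys a \<subseteq> Z" for a
    unfolding monomial_def
    by (rule single_mem_mpoly_ring keys_pushforward_subset[OF that g] keys_pushforward_subset[OF that h])+
  have keys: "Poly_Mapping.keys a \<subseteq> Z" if "a \<in> Poly_Mapping.keys p" for a
    using that p by (simp add: mem_carrier_mpoly_ring)
  have "?\<kappa> ` Poly_Mapping.keys p \<subseteq> carrier B.quotient \<times> carrier C.quotient"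
    using B.quot_class_closed[OF monomials(1)[OF keys]] C.quot_class_closed[OF monomials(2)[OF keys]]
    by auto
  then have closed: "pushforward ?\<kappa> p \<in> carrier free"
    using keys_pushforward[of ?\<kappa> p] by (simp add: mem_carrier_free_algebra)
  have theta: "theta (pushforward ?\<kappa> p) = pushforward ?w p"
  proof (induction p rule: poly_mapping_additive_induct)
    case (single a c)
    then show ?case
      using monomials[OF keys] by (simp add: B.val_quot_class C.val_quot_class)
        (simp add: monomial_def mult_single)
  qed (simp_all add: pushforward_add theta_add)
  have "pushforward ?\<kappa> p = 0" if "pushforward ?w p = 0"
  proof -
    \<comment> \<open>The pair of classes \<open>?\<kappa> a\<close> factors through the weight of
      \<open>a\<close>. Hence vanishing of the push-forward by weight makes the representing vector
      zero already in the free algebra, not merely modulo the relations.\<close>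
    define rep where "rep s = (SOME a. Poly_Mapping.keys a \<subseteq> Z \<and> ?w a = s)" for s
    have "?\<kappa> (rep (?w a)) = ?\<kappa> a" if "a \<in> Poly_Mapping.keys p" for a
    proof -
      have rep: "Poly_Mapping.keys (rep (?w a)) \<subseteq> Z \<and> ?w (rep (?w a)) = ?w a"
        unfolding rep_def by (rule someI[of _ a]) (use keys that in auto)
      then have "wB (pushforward g (rep (?w a))) = wB (pushforward g a)"
        "wC (pushforward h (rep (?w a))) = wC (pushforward h a)"
        using independent by blast+
      then show ?thesis
        using B.quot_class_eqI[OF monomials(1)[OF conjunct1[OF rep]] monomials(1)[OF keys[OF that]]]
          C.quot_class_eqI[OF monomials(2)[OF conjunct1[OF rep]] monomials(2)[OF keys[OF that]]]
        by (simp add: monomial_def)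
    qed
    then have "pushforward ?\<kappa> p = pushforward (\<lambda>s. ?\<kappa> (rep s)) (pushforward ?w p)"
      unfolding pushforward_pushforward by (intro pushforward_cong) simp
    with that show ?thesis by simp
  qed
  moreover have "0 \<in> kernel_ideal"
    using additive_subgroup.zero_closed[OF ideal.axioms(1)[OF ideal_kernel_ideal]] by simp
  ultimately have "pushforward ?\<kappa> p \<in> kernel_ideal \<longleftrightarrow> pushforward ?w p = 0"
    using theta theta_kernel_ideal[of "pushforward ?\<kappa> p"] by auto
  then show ?thesis
    unfolding mpoly_eval_eq[OF assms] coset_eq_zero_iff[OF closed] .
qed

end

section \<open>Homogeneity\<close>

text \<open>If the degree of each variable is one fixed linear function of its column, the
  multidegree of a monomial is the same function of its weight. The two terms of a generator have
  equal weight, so every generator is homogeneous. The coefficients \<open>c\<close> are real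
  because they will come from a real row space.\<close>

lemma homogeneous_toric_ideal:
  fixes c :: "nat \<Rightarrow> nat \<Rightarrow> real"
  assumes "finite X"
    and deg: "\<And>x t. x \<in> X \<Longrightarrow> t < f \<Longrightarrow> real_of_int (deg x $ t) = (\<Sum>i<n. c t i * real (M i x))"
  shows "homogeneous_ideal f X deg (toric_ideal n X M)"
proof -
  interpret R: cring "mpoly_ring X" by (rule cring_mpoly_ring)
  let ?G = "{monomial a - monomial b | a b. Poly_Mapping.keys a \<subseteq> X \<and> Poly_Mapping.keys b \<subseteq> X \<and>
        (\<forall>i<n. (\<Sum>x\<in>X. M i x * Poly_Mapping.lookup a x) = (\<Sum>x\<in>X. M i x * Poly_Mapping.lookup b x))}"
  let ?I = "toric_ideal n X M"
  have G: "?G \<subseteq> carrier (mpoly_ring X)"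
    by (auto simp: monomial_def intro!: mpoly_ring_minus single_mem_mpoly_ring)
  have I: "ideal ?I (mpoly_ring X)"
    unfolding toric_ideal_def using G by (rule R.genideal_ideal)
  have GI: "?G \<subseteq> ?I" unfolding toric_ideal_def by (rule R.genideal_self[OF G])
  have multidegree: "real_of_int (multidegree f deg a $ t)
      = (\<Sum>i<n. c t i * real (\<Sum>x\<in>X. M i x * Poly_Mapping.lookup a x))"
    if "Poly_Mapping.keys a \<subseteq> X" "t < f" for a t
  proof -
    have "multidegree f deg a $ t = (\<Sum>x\<in>Poly_Mapping.keys a. int (Poly_Mapping.lookup a x) * deg x $ t)"
      using that by (simp add: multidegree_def)
    also have "\<dots> = (\<Sum>x\<in>X. int (Poly_Mapping.lookup a x) * deg x $ t)"
      using that assms(1) by (intro sum.mono_neutral_left) (auto simp: in_keys_iff)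
    finally have "real_of_int (multidegree f deg a $ t)
        = (\<Sum>x\<in>X. real (Poly_Mapping.lookup a x) * (\<Sum>i<n. c t i * real (M i x)))"
      using deg that(2) by simp
    also have "\<dots> = (\<Sum>x\<in>X. \<Sum>i<n. c t i * (real (M i x) * real (Poly_Mapping.lookup a x)))"
      by (simp add: sum_distrib_left mult_ac)
    also have "\<dots> = (\<Sum>i<n. c t i * real (\<Sum>x\<in>X. M i x * Poly_Mapping.lookup a x))"
      by (subst sum.swap) (simp add: sum_distrib_left)
    finally show ?thesis .
  qed
  have "homogeneous f deg p" if pG: "p \<in> ?G" for p
  proof -
    obtain a b where p: "p = monomial a - monomial b" and ab: "Poly_Mapping.keys a \<subseteq> X" "Poly_Mapping.keys b \<subseteq> X"
      and eq: "\<And>i. i < n \<Longrightarrow> (\<Sum>x\<in>X. M i x * Poly_Mapping.lookup a x) = (\<Sum>x\<in>X. M i x * Poly_Mapping.lookup b x)"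
      using pG by blast
    have "multidegree f deg a $ t = multidegree f deg b $ t" if "t < f" for t
    proof -
      have "real_of_int (multidegree f deg a $ t) = real_of_int (multidegree f deg b $ t)"
        unfolding multidegree[OF ab(1) that] multidegree[OF ab(2) that] by (simp add: eq)
      then show ?thesis by (simp only: of_int_eq_iff)
    qed
    then have "multidegree f deg a = multidegree f deg b"
      by (intro eq_vecI) (simp_all add: multidegree_def[of f deg, THEN arg_cong[of _ _ dim_vec]])
    moreover have "Poly_Mapping.keys p \<subseteq> {a, b}"
      unfolding p monomial_def using keys_diff by fastforce
    ultimately show ?thesis unfolding homogeneous_def by (intro exI[of _ "multidegree f deg b"]) auto
  qed
  then have GH: "?G \<subseteq> {p \<in> ?I. homogeneous f deg p}" using GI by blast
  have H: "{p \<in> ?I. homogeneous f deg p} \<subseteq> carrier (mpoly_ring X)"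
    using additive_subgroup.a_subset[OF ideal.axioms(1)[OF I]] by blast
  have "Idl\<^bsub>mpoly_ring X\<^esub> {p \<in> ?I. homogeneous f deg p} \<subseteq> ?I"
    by (rule R.genideal_minimal[OF I]) blast
  moreover have "?I \<subseteq> Idl\<^bsub>mpoly_ring X\<^esub> {p \<in> ?I. homogeneous f deg p}"
    unfolding toric_ideal_def[of n X M]
    using GH R.genideal_self[OF H]
    by (intro R.genideal_minimal R.genideal_ideal) (auto simp: H[unfolded toric_ideal_def] toric_ideal_def)
  ultimately show ?thesis unfolding homogeneous_ideal_def using I by blast
qed

section \<open>Renaming of variables\<close>

text \<open>The evaluation is written with the sums, products and powers of the ring structure;
  these agree with the operations of the polynomial type as long as all terms lie in the carrier.
  The inner push-forward renames variables within an exponent vector, the outer one moves the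
  terms.\<close>

lemma rename_vars_eq:
  assumes p: "p \<in> carrier (mpoly_ring V)" and \<sigma>: "\<sigma> ` V \<subseteq> Z"
  shows "rename_vars Z \<sigma> p = pushforward (pushforward \<sigma>) p"
proof -
  interpret R: cring "mpoly_ring Z" by (rule cring_mpoly_ring)
  have finprod: "(\<Otimes>\<^bsub>mpoly_ring Z\<^esub>i\<in>K. F i) = prod F K \<and> prod F K \<in> carrier (mpoly_ring Z)"
    if "finite K" "F ` K \<subseteq> carrier (mpoly_ring Z)" for F :: "'a \<Rightarrow> 'b mpoly" and K
    using that
  proof induction
    case empty
    then show ?case using R.one_closed by simp
  next
    case (insert k K)
    then show ?case using R.m_closed[of "F k" "prod F K"] by (auto simp: R.finprod_insert image_subset_iff_funcset)
  qed
  have finsum: "(\<Oplus>\<^bsub>mpoly_ring Z\<^esub>i\<in>K. F i) = sum F K \<and> sum F K \<in> carrier (mpoly_ring Z)"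
    if "finite K" "F ` K \<subseteq> carrier (mpoly_ring Z)" for F :: "('a \<Rightarrow>\<^sub>0 nat) \<Rightarrow> 'b mpoly" and K
    using that
  proof induction
    case empty
    then show ?case using R.zero_closed by simp
  next
    case (insert k K)
    then show ?case using R.a_closed[of "F k" "sum F K"] by (auto simp: R.finsum_insert image_subset_iff_funcset)
  qed
  have power: "q [^]\<^bsub>mpoly_ring Z\<^esub> (n::nat) = q ^ n" for q n
    by (induction n) (simp_all add: mult.commute)
  have var_power: "var x ^ n = monomial (Poly_Mapping.single x n)" for x :: 'b and n
    by (induction n) (simp_all add: var_def monomial_def mult_single flip: single_add)
  have mon: "(\<Prod>i\<in>K. monomial (b i)) = monomial (\<Sum>i\<in>K. b i)"
    if "finite K" for K :: "'a set" and b :: "'a \<Rightarrow> 'b \<Rightarrow>\<^sub>0 nat"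
    using that by induction (simp_all add: monomial_def mult_single)
  have summand: "const c * (\<Otimes>\<^bsub>mpoly_ring Z\<^esub>i\<in>Poly_Mapping.keys a. var (\<sigma> i) [^]\<^bsub>mpoly_ring Z\<^esub> Poly_Mapping.lookup a i)
      = Poly_Mapping.single (pushforward \<sigma> a) c" if "Poly_Mapping.keys a \<subseteq> V" for a c
  proof -
    have "(\<lambda>i. monomial (Poly_Mapping.single (\<sigma> i) (Poly_Mapping.lookup a i))) ` Poly_Mapping.keys a
        \<subseteq> carrier (mpoly_ring Z)"
      using that \<sigma> by (auto simp: monomial_def subset_iff intro!: single_mem_mpoly_ring split: if_splits)
    then have "(\<Otimes>\<^bsub>mpoly_ring Z\<^esub>i\<in>Poly_Mapping.keys a. var (\<sigma> i) [^]\<^bsub>mpoly_ring Z\<^esub> Poly_Mapping.lookup a i)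
        = monomial (pushforward \<sigma> a)"
      by (simp add: power var_power finprod mon pushforward_def)
    then show ?thesis by (simp add: const_def monomial_def mult_single)
  qed
  have keys: "Poly_Mapping.keys a \<subseteq> V" if "a \<in> Poly_Mapping.keys p" for a
    using that p by (simp add: mem_carrier_mpoly_ring)
  let ?s = "\<lambda>a. Poly_Mapping.single (pushforward \<sigma> a) (Poly_Mapping.lookup p a)"
  have s: "?s ` Poly_Mapping.keys p \<subseteq> carrier (mpoly_ring Z)"
    using single_mem_mpoly_ring[OF keys_pushforward_subset[OF keys \<sigma>]] by blast
  have "rename_vars Z \<sigma> p = (\<Oplus>\<^bsub>mpoly_ring Z\<^esub>a\<in>Poly_Mapping.keys p. ?s a)"
    unfolding rename_vars_def mpoly_eval_def
    using s by (intro R.finsum_cong' refl) (auto simp: summand keys)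
  also have "\<dots> = pushforward (pushforward \<sigma>) p"
    using finsum[OF _ s] by (simp add: pushforward_def[of "pushforward \<sigma>"])
  finally show ?thesis .
qed

lemma pushforward_mem_mpoly_ring:
  assumes "p \<in> carrier (mpoly_ring V)" "\<sigma> ` V \<subseteq> Z"
  shows "pushforward (pushforward \<sigma>) p \<in> carrier (mpoly_ring Z)"
proof -
  have "Poly_Mapping.keys (pushforward (pushforward \<sigma>) p) \<subseteq> pushforward \<sigma> ` Poly_Mapping.keys p"
    by (rule keys_pushforward)
  moreover have "Poly_Mapping.keys (pushforward \<sigma> a) \<subseteq> Z" if "a \<in> Poly_Mapping.keys p" for a
    using that assms keys_pushforward_subset[of a V \<sigma> Z] by (simp add: mem_carrier_mpoly_ring)
  ultimately show ?thesis unfolding mem_carrier_mpoly_ring by blast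
qed

text \<open>Renaming along a bijection is invertible, with the inverse renaming supplying preimages.
  This transports the kernel of \<open>psi\<close> to the toric fiber product once both are kernels
  of compatible weights.\<close>

lemma rename_vars_image_kernel:
  assumes \<sigma>: "bij_betw \<sigma> V Z"
  shows "rename_vars Z \<sigma> ` {p \<in> carrier (mpoly_ring V). pushforward (\<lambda>a. w (pushforward \<sigma> a)) p = 0}
    = {q \<in> carrier (mpoly_ring Z). pushforward w q = 0}"
proof -
  have sub: "\<sigma> ` V \<subseteq> Z" using \<sigma> by (simp add: bij_betw_def)
  let ?\<tau> = "inv_into V \<sigma>"
  have sub': "?\<tau> ` Z \<subseteq> V" using bij_betw_inv_into[OF \<sigma>] by (simp add: bij_betw_def)
  show ?thesis
  proof (intro equalityI subsetI)
    fix q assume "q \<in> rename_vars Z \<sigma> ` {p \<in> carrier (mpoly_ring V). pushforward (\<lambda>a. w (pushforward \<sigma> a)) p = 0}"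
    then obtain p where p: "p \<in> carrier (mpoly_ring V)" "pushforward (\<lambda>a. w (pushforward \<sigma> a)) p = 0"
      and q: "q = rename_vars Z \<sigma> p" by blast
    have "q = pushforward (pushforward \<sigma>) p" unfolding q by (rule rename_vars_eq[OF p(1) sub])
    then show "q \<in> {q \<in> carrier (mpoly_ring Z). pushforward w q = 0}"
      using p pushforward_mem_mpoly_ring[OF p(1) sub] by (simp add: pushforward_pushforward)
  next
    fix q assume "q \<in> {q \<in> carrier (mpoly_ring Z). pushforward w q = 0}"
    then have q: "q \<in> carrier (mpoly_ring Z)" "pushforward w q = 0" by auto
    define p where "p = pushforward (pushforward ?\<tau>) q"
    have p: "p \<in> carrier (mpoly_ring V)"
      unfolding p_def by (rule pushforward_mem_mpoly_ring[OF q(1) sub'])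
    \<comment> \<open>The inverse is a true inverse only on \<open>Z\<close>, which contains the
      keys of every exponent vector occurring in \<open>q\<close>.\<close>
    have inv: "pushforward \<sigma> (pushforward ?\<tau> a) = a" if "a \<in> Poly_Mapping.keys q" for a
    proof -
      have "pushforward (\<lambda>k. \<sigma> (?\<tau> k)) a = pushforward (\<lambda>k. k) a"
        by (rule pushforward_cong) (use that q(1) \<sigma> bij_betw_inv_into_right in \<open>fastforce simp: mem_carrier_mpoly_ring\<close>)
      then show ?thesis by (simp add: pushforward_pushforward)
    qed
    have "pushforward (pushforward \<sigma>) p = pushforward (\<lambda>a. a) q"
      unfolding p_def pushforward_pushforward[of "pushforward \<sigma>"] by (rule pushforward_cong) (rule inv)
    then have eq: "pushforward (pushforward \<sigma>) p = q" by simp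
    then have "pushforward (\<lambda>a. w (pushforward \<sigma> a)) p = 0"
      using q(2) pushforward_pushforward[of w "pushforward \<sigma>" p] by simp
    moreover have "rename_vars Z \<sigma> p = q" using rename_vars_eq[OF p sub] eq by simp
    ultimately show "q \<in> rename_vars Z \<sigma> ` {p \<in> carrier (mpoly_ring V). pushforward (\<lambda>a. w (pushforward \<sigma> a)) p = 0}"
      using p by blast
  qed
qed

section \<open>Partition matrices and florets\<close>

lemma partition_matrix_support:
  assumes "partition_matrix m M" "i < dim_row M"
  shows "row_support M i = {j. j < m \<and> M $$ (i, j) = 1}"
proof -
  have dim: "dim_col M = m" and "\<And>j. j < m \<Longrightarrow> M $$ (i, j) \<in> {0, 1}"
    using assms by (simp_all add: partition_matrix_def)
  then have "j < m \<Longrightarrow> M $$ (i, j) \<noteq> 0 \<longleftrightarrow> M $$ (i, j) = 1" for j by force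
  then show ?thesis unfolding row_support_def dim by blast
qed

lemma partition_matrix_support_nonempty:
  assumes "partition_matrix m M" "i < dim_row M"
  shows "row_support M i \<noteq> {}"
proof
  assume "row_support M i = {}"
  with assms have "row M i = 0\<^sub>v m"
    by (intro eq_vecI) (auto simp: row_support_def partition_matrix_def)
  with assms show False by (simp add: partition_matrix_def)
qed

lemma partition_matrix_row_exists:
  assumes "partition_matrix m M" "j < m"
  obtains i where "i < dim_row M" "j \<in> row_support M i"
proof -
  have "\<exists>!i. i < dim_row M \<and> M $$ (i, j) = 1" using assms by (simp add: partition_matrix_def)
  then obtain i where "i < dim_row M" "M $$ (i, j) = 1" by blast
  then show thesis using assms(2) that[of i] by (simp add: partition_matrix_support[OF assms(1)])
qed

lemma partition_matrix_row_unique: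
  assumes "partition_matrix m M" "i < dim_row M" "i' < dim_row M"
    and "j \<in> row_support M i" "j \<in> row_support M i'"
  shows "i = i'"
proof -
  have "j < m" "M $$ (i, j) = 1" "M $$ (i', j) = 1"
    using assms(4,5) by (simp_all add: partition_matrix_support[OF assms(1)] assms(2,3))
  moreover have "\<exists>!i. i < dim_row M \<and> M $$ (i, j) = 1"
    using assms(1) \<open>j < m\<close> by (simp add: partition_matrix_def)
  ultimately show ?thesis using assms(2,3) by blast
qed

lemma partition_matrix_entry:
  assumes "partition_matrix m M" "i < dim_row M" "k < dim_row M" "j \<in> row_support M i"
  shows "M $$ (k, j) = (if k = i then 1 else 0)"
proof -
  have j: "j < m" "M $$ (i, j) = 1"
    using assms(4) by (simp_all add: partition_matrix_support[OF assms(1,2)])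
  have "M $$ (k, j) \<in> {0, 1}" using assms(1,3) j by (simp add: partition_matrix_def)
  moreover have "M $$ (k, j) \<noteq> 1" if "k \<noteq> i"
    using partition_matrix_row_unique[OF assms(1,3,2) _ assms(4)] that j(1)
    by (auto simp: partition_matrix_support[OF assms(1,3)])
  ultimately show ?thesis using j by auto
qed

lemma dim_Cup [simp]: "dim_row (Cup M lam) = num_cols M" "dim_col (Cup M lam) = dim_col M"
  by (simp_all add: Cup_def)

lemma Cup_entry:
  assumes "u < num_cols M" "j < dim_col M"
  shows "Cup M lam $$ (u, j) = (if lam j = u then 1 else 0)"
  using assms by (auto simp: Cup_def mat_of_cols_index unit_vec_def)

lemma Cup_support:
  "u < num_cols M \<Longrightarrow> row_support (Cup M lam) u = {j. j < dim_col M \<and> lam j = u}"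
  by (auto simp: row_support_def Cup_entry split: if_splits)

text \<open>Rows are nonzero because the labeling is onto; column \<open>j\<close> has its single 1
  in row \<open>lam j\<close>.\<close>

lemma partition_matrix_Cup:
  assumes "labeling M lam"
  shows "partition_matrix (dim_col M) (Cup M lam)"
proof -
  have surj: "lam ` {..<dim_col M} = {..<num_cols M}" using assms by (simp add: labeling_def)
  have "row (Cup M lam) i \<noteq> 0\<^sub>v (dim_col M)" if i: "i < num_cols M" for i
  proof -
    have "i \<in> lam ` {..<dim_col M}" using i surj by simp
    then obtain j where j: "j < dim_col M" "lam j = i" by auto
    have "row (Cup M lam) i $ j = 1" using i j by (simp add: Cup_entry)
    then show ?thesis using j by auto
  qed
  moreover have "\<exists>!i. i < num_cols M \<and> Cup M lam $$ (i, j) = 1" if j: "j < dim_col M" for j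
  proof (rule ex1I[of _ "lam j"])
    have "lam j < num_cols M" using j surj by auto
    then show "lam j < num_cols M \<and> Cup M lam $$ (lam j, j) = 1"
      using j by (simp add: Cup_entry)
  qed (use j in \<open>auto simp: Cup_entry split: if_splits\<close>)
  ultimately show ?thesis by (auto simp: partition_matrix_def Cup_entry)
qed

section \<open>Floret indices of the rows of two partition matrices\<close>

locale florets =
  fixes m :: nat and B C :: "nat mat" and Fs :: "nat set list"
  assumes partB: "partition_matrix m B" and partC: "partition_matrix m C"
    and floret: "floret_condition B C" and Fs: "floret_list B C Fs"
begin

lemma neighbours_nonempty:
  assumes u: "u < dim_row B"
  shows "neighbours B C u \<noteq> {}"
proof -
  obtain j where j: "j \<in> row_support B u" using partition_matrix_support_nonempty[OF partB u] by blast
  then have "j < m" by (simp add: partition_matrix_support[OF partB u])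
  then obtain v where "v < dim_row C" "j \<in> row_support C v" by (rule partition_matrix_row_exists[OF partC])
  then show ?thesis using j by (auto simp: neighbours_def connected_rows_def)
qed

lemma connected_exists:
  assumes v: "v < dim_row C"
  obtains u where "u < dim_row B" "connected_rows B C u v"
proof -
  obtain j where j: "j \<in> row_support C v" using partition_matrix_support_nonempty[OF partC v] by blast
  then have "j < m" by (simp add: partition_matrix_support[OF partC v])
  then obtain u where "u < dim_row B" "j \<in> row_support B u" by (rule partition_matrix_row_exists[OF partB])
  then show thesis using j that by (auto simp: connected_rows_def)
qed

text \<open>Two florets with a common row are equal sets by the floret condition, and a set occurs
  only once in \<open>Fs\<close>. This is the uniqueness behind the definite descriptions of both
  floret indices.\<close>

lemma floret_eqI:
  assumes "t < length Fs" "t' < length Fs" "v \<in> Fs ! t" "v \<in> Fs ! t'"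
  shows "t = t'"
proof -
  have "Fs ! t \<in> neighbours B C ` {..<dim_row B}" "Fs ! t' \<in> neighbours B C ` {..<dim_row B}"
    using Fs assms(1,2) nth_mem unfolding floret_list_def by blast+
  then have "Fs ! t = Fs ! t'"
    using floret assms(3,4) unfolding floret_condition_def by blast
  then show ?thesis using Fs assms(1,2) by (simp add: floret_list_def nth_eq_iff_index_eq)
qed

lemma floret_index_exists:
  assumes "u < dim_row B"
  obtains t where "t < length Fs" "Fs ! t = neighbours B C u"
proof -
  have "neighbours B C u \<in> set Fs" using Fs assms by (simp add: floret_list_def)
  then show thesis using that by (auto simp: in_set_conv_nth)
qed

lemma floret_of_C_eqI:
  assumes "t < length Fs" "v \<in> Fs ! t"
  shows "floret_of_C Fs v = t"
  unfolding floret_of_C_def 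
proof (rule the_equality)
  show "t' = t" if "t' < length Fs \<and> v \<in> Fs ! t'" for t'
    using floret_eqI[of t' t v] that assms by simp
qed (simp add: assms)

text \<open>For uniqueness, if \<open>u\<close> also belongs to index \<open>t'\<close>, then some
  \<open>v\<close> in \<open>Fs ! t'\<close> is connected to \<open>u\<close> and so lies in the
  neighbour set \<open>Fs ! t\<close> as well; the two florets share a row.\<close>

lemma floret_of_B_eqI:
  assumes u: "u < dim_row B" and t: "t < length Fs" "Fs ! t = neighbours B C u"
  shows "floret_of_B B C Fs u = t"
  unfolding floret_of_B_def
proof (rule the_equality)
  obtain v where v: "v \<in> neighbours B C u" using neighbours_nonempty[OF u] by blast
  then show "t < length Fs \<and> u \<in> floret_rows_B B C Fs t"
    using t u by (auto simp: floret_rows_B_def neighbours_def)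
next
  fix t' assume t': "t' < length Fs \<and> u \<in> floret_rows_B B C Fs t'"
  then obtain v where v: "v \<in> Fs ! t'" "connected_rows B C u v" by (auto simp: floret_rows_B_def)
  have "Fs ! t' \<in> neighbours B C ` {..<dim_row B}"
    using Fs t' nth_mem unfolding floret_list_def by blast
  then have "v \<in> neighbours B C u" using v by (auto simp: neighbours_def)
  then show "t' = t" using floret_eqI[of t' t v] t t' v by simp
qed

lemma floret_of_B:
  assumes "u < dim_row B"
  shows "floret_of_B B C Fs u < length Fs" "Fs ! floret_of_B B C Fs u = neighbours B C u"
proof -
  obtain t where t: "t < length Fs" "Fs ! t = neighbours B C u"
    by (rule floret_index_exists[OF assms])
  show "floret_of_B B C Fs u < length Fs" "Fs ! floret_of_B B C Fs u = neighbours B C u"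
    unfolding floret_of_B_eqI[OF assms t] by (rule t)+
qed

lemma floret_of_C:
  assumes "v < dim_row C"
  shows "floret_of_C Fs v < length Fs" "v \<in> Fs ! floret_of_C Fs v"
proof -
  obtain u where u: "u < dim_row B" "connected_rows B C u v" by (rule connected_exists[OF assms])
  have v: "v \<in> Fs ! floret_of_B B C Fs u"
    using assms u by (simp add: floret_of_B(2) neighbours_def)
  show "floret_of_C Fs v < length Fs" "v \<in> Fs ! floret_of_C Fs v"
    unfolding floret_of_C_eqI[OF floret_of_B(1)[OF u(1)] v] by (rule floret_of_B(1)[OF u(1)] v)+
qed

text \<open>The floret with the index of \<open>u\<close> is exactly the neighbour set of
  \<open>u\<close>, so sharing an index means being a neighbour. This matches the superscripts of
  the variables with the pairs that occur as columns.\<close>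

lemma floret_of_B_eq_floret_of_C_iff:
  assumes "u < dim_row B" "v < dim_row C"
  shows "floret_of_B B C Fs u = floret_of_C Fs v \<longleftrightarrow> connected_rows B C u v"
proof
  assume "floret_of_B B C Fs u = floret_of_C Fs v"
  with floret_of_C(2)[OF assms(2)] have "v \<in> neighbours B C u"
    using floret_of_B(2)[OF assms(1)] by simp
  then show "connected_rows B C u v" by (simp add: neighbours_def)
next
  assume "connected_rows B C u v"
  then have "v \<in> Fs ! floret_of_B B C Fs u" using assms by (simp add: floret_of_B(2) neighbours_def)
  then show "floret_of_B B C Fs u = floret_of_C Fs v"
    using floret_of_C_eqI[OF floret_of_B(1)[OF assms(1)]] by simp
qed

text \<open>The row of \<open>C\<close> that contains column \<open>j\<close> is connected to
  \<open>u\<close> through \<open>j\<close> itself, so it lies in the floret of \<open>u\<close>.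
  Thus column \<open>j\<close> of the matrix is the multidegree of the variables attached to
  \<open>u\<close>, which links the row space condition to the grading.\<close>

lemma Cap_entry:
  assumes u: "u < dim_row B" and j: "j \<in> row_support B u" and t: "t < length Fs"
  shows "Cap C Fs $$ (t, j) = (if t = floret_of_B B C Fs u then 1 else 0)"
proof -
  have "j < m" using j by (simp add: partition_matrix_support[OF partB u])
  then obtain v where v: "v < dim_row C" "j \<in> row_support C v" by (rule partition_matrix_row_exists[OF partC])
  then have tu: "floret_of_B B C Fs u = floret_of_C Fs v"
    using j floret_of_B_eq_floret_of_C_iff[OF u v(1)] by (auto simp: connected_rows_def)
  have "(\<exists>v\<in>Fs ! t. j \<in> row_support C v) \<longleftrightarrow> t = floret_of_C Fs v"
  proof
    assume "\<exists>v\<in>Fs ! t. j \<in> row_support C v"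
    then obtain v' where v': "v' \<in> Fs ! t" "j \<in> row_support C v'" by blast
    have "Fs ! t \<in> neighbours B C ` {..<dim_row B}"
      using Fs t nth_mem unfolding floret_list_def by blast
    then have "v' < dim_row C" using v' by (auto simp: neighbours_def)
    then have "v' = v" using partition_matrix_row_unique[OF partC _ v(1) v'(2) v(2)] by simp
    then show "t = floret_of_C Fs v" using floret_of_C_eqI[OF t] v' by simp
  next
    assume "t = floret_of_C Fs v"
    then show "\<exists>v\<in>Fs ! t. j \<in> row_support C v" using floret_of_C(2)[OF v(1)] v(2) by blast
  qed
  moreover have "j < dim_col C" using \<open>j < m\<close> partC by (simp add: partition_matrix_def)
  ultimately show ?thesis using t tu by (simp add: Cap_def)
qed

end

section \<open>Stacked matrices\<close>

lemma dim_stack_append [simp]: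
  "dim_row (stack m (As @ [M])) = dim_row (stack m As) + dim_row M"
  "dim_col (stack m As) = m"
  by (simp_all add: stack_def)

lemma stack_append_entry:
  assumes "dim_col M = m" "i < dim_row (stack m As) + dim_row M" "j < m"
  shows "stack m (As @ [M]) $$ (i, j) = (if i < dim_row (stack m As) then stack m As $$ (i, j)
    else M $$ (i - dim_row (stack m As), j))"
  using assms by (auto simp: stack_def mat_of_rows_index nth_append)

text \<open>This turns \<open>omega\<close> into the size of an intersection of supports, hence its
  nonvanishing into connectedness.\<close>

lemma cols_of_form_eq:
  assumes B: "partition_matrix m B" and C: "partition_matrix m C" and u: "u < dim_row B" and v: "v < dim_row C"
  shows "cols_of_form B C u v = row_support B u \<inter> row_support C v"
proof -
  have dim: "dim_col B = m" "dim_col C = m" using B C by (simp_all add: partition_matrix_def)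
  have row0: "dim_row (stack m []) = 0" by (simp add: stack_def)
  have row1: "dim_row (stack m [B]) = dim_row B" using dim_stack_append(1)[of m "[]" B] row0 by simp
  have row2: "dim_row (stack m [B, C]) = dim_row B + dim_row C"
    using dim_stack_append(1)[of m "[B]" C] row1 by simp
  have st: "stack m [B, C] $$ (i, j) = (if i < dim_row B then B $$ (i, j) else C $$ (i - dim_row B, j))"
    if "i < dim_row B + dim_row C" "j < m" for i j
    using stack_append_entry[of C m i "[B]" j] stack_append_entry[of B m i "[]" j] dim that
    by (simp add: row0 row1)
  have "col (stack m [B, C]) j = unit_vec (dim_row B) u @\<^sub>v unit_vec (dim_row C) v
      \<longleftrightarrow> j \<in> row_support B u \<and> j \<in> row_support C v" if j: "j < m" for j
  proof
    assume eq: "col (stack m [B, C]) j = unit_vec (dim_row B) u @\<^sub>v unit_vec (dim_row C) v"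
    from arg_cong[OF eq, of "\<lambda>w. w $ u"] have "B $$ (u, j) = 1"
      using u j by (simp add: row2 st)
    moreover from arg_cong[OF eq, of "\<lambda>w. w $ (dim_row B + v)"] have "C $$ (v, j) = 1"
      using v j by (simp add: row2 st)
    ultimately show "j \<in> row_support B u \<and> j \<in> row_support C v"
      using j by (simp add: partition_matrix_support[OF B u] partition_matrix_support[OF C v])
  next
    assume *: "j \<in> row_support B u \<and> j \<in> row_support C v"
    show "col (stack m [B, C]) j = unit_vec (dim_row B) u @\<^sub>v unit_vec (dim_row C) v"
    proof (rule eq_vecI)
      fix i assume "i < dim_vec (unit_vec (dim_row B) u @\<^sub>v unit_vec (dim_row C) v)"
      then have i: "i < dim_row B + dim_row C" by simp
      show "col (stack m [B, C]) j $ i = (unit_vec (dim_row B) u @\<^sub>v unit_vec (dim_row C) v) $ i"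
      proof (cases "i < dim_row B")
        case True
        then show ?thesis
          using i j u * partition_matrix_entry[OF B u True] by (simp add: row2 st unit_vec_def)
      next
        case False
        then have "i - dim_row B < dim_row C" using i by simp
        then show ?thesis
          using i j v False * partition_matrix_entry[OF C v, of "i - dim_row B"]
          by (simp add: row2 st unit_vec_def)
      qed
    qed (simp add: row2)
  qed
  then show ?thesis
    using dim by (auto simp: cols_of_form_def) (auto simp: row_support_def)
qed

section \<open>The kernel of the map into the tensor product\<close>

text \<open>Padding with 0 from index \<open>n\<close> on makes equality of weights an equality of
  functions, and these form a commutative monoid under pointwise addition, as a weight map
  requires.\<close>

definition toric_weight :: "nat \<Rightarrow> 'x set \<Rightarrow> (nat \<Rightarrow> 'x \<Rightarrow> nat) \<Rightarrow> ('x \<Rightarrow>\<^sub>0 nat) \<Rightarrow> nat \<Rightarrow> nat" where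
  "toric_weight n X M a = (\<lambda>i. if i < n then \<Sum>x\<in>X. M i x * Poly_Mapping.lookup a x else 0)"

lemma toric_weight_add: "toric_weight n X M (a + b) = toric_weight n X M a + toric_weight n X M b"
  by (auto simp: toric_weight_def fun_eq_iff lookup_add distrib_left sum.distrib)

lemma toric_weight_zero: "toric_weight n X M 0 = 0"
  by (auto simp: toric_weight_def fun_eq_iff)

lemma toric_weight_eq_iff:
  "toric_weight n X M a = toric_weight n X M b \<longleftrightarrow>
    (\<forall>i<n. (\<Sum>x\<in>X. M i x * Poly_Mapping.lookup a x) = (\<Sum>x\<in>X. M i x * Poly_Mapping.lookup b x))"
  by (auto simp: toric_weight_def fun_eq_iff)

text \<open>Division with remainder by \<open>y v\<close> identifies the numbers below
  \<open>x u * y v\<close> with pairs of numbers below \<open>x u\<close> and \<open>y v\<close>.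
  Pairs \<open>(u, v)\<close> with different superscripts have no column at all, and equal
  superscripts force \<open>omega\<close> to be the full product.\<close>

lemma bij_betw_split_index:
  assumes y: "\<And>v. v < dim_row C \<Longrightarrow> y v > 0"
    and omega: "\<And>u v. u < dim_row B \<Longrightarrow> v < dim_row C \<Longrightarrow> omega B C u v \<noteq> 0 \<Longrightarrow> omega B C u v = x u * y v"
    and t: "\<And>u v. u < dim_row B \<Longrightarrow> v < dim_row C \<Longrightarrow> tu u = tv v \<longleftrightarrow> omega B C u v \<noteq> 0"
  shows "bij_betw (split_index y) (col_index B C)
    (tfp_vars (SIGMA u:{..<dim_row B}. {..<x u}) (\<lambda>(u, s'). tu u)
       (SIGMA v:{..<dim_row C}. {..<y v}) (\<lambda>(v, s''). tv v))"
    (is "bij_betw _ ?V ?Z")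
proof (rule bij_betw_byWitness[where f' = "\<lambda>((u, s'), (v, s'')). (u, v, s' * y v + s'')"])
  show "\<forall>k\<in>?V. (\<lambda>((u, s'), (v, s'')). (u, v, s' * y v + s'')) (split_index y k) = k"
    by (auto simp: split_index_def)
  show "\<forall>k\<in>?Z. split_index y ((\<lambda>((u, s'), (v, s'')). (u, v, s' * y v + s'')) k) = k"
    by (auto simp: split_index_def tfp_vars_def)
  show "split_index y ` ?V \<subseteq> ?Z"
  proof
    fix z assume "z \<in> split_index y ` ?V"
    then obtain u v s where z: "z = split_index y (u, v, s)"
      and *: "u < dim_row B" "v < dim_row C" "s < omega B C u v" by (auto simp: col_index_def)
    then have "s < x u * y v" using omega[of u v] by simp
    then have "s div y v < x u" "s mod y v < y v"
      using y[of v] * by (simp_all add: less_mult_imp_div_less)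
    then show "z \<in> ?Z"
      using * t[of u v] by (simp add: z split_index_def tfp_vars_def)
  qed
  show "(\<lambda>((u, s'), (v, s'')). (u, v, s' * y v + s'')) ` ?Z \<subseteq> ?V"
  proof
    fix z assume "z \<in> (\<lambda>((u, s'), (v, s'')). (u, v, s' * y v + s'')) ` ?Z"
    then obtain u v s' s'' where z: "z = (u, v, s' * y v + s'')"
      and *: "u < dim_row B" "s' < x u" "v < dim_row C" "s'' < y v" "tu u = tv v"
      by (auto simp: tfp_vars_def)
    then have "omega B C u v = x u * y v" using omega t by simp
    moreover have "s' * y v + s'' < Suc s' * y v" using * by simp
    moreover have "Suc s' * y v \<le> x u * y v" using * by (intro mult_le_mono1) simp
    ultimately have "s' * y v + s'' < omega B C u v" by linarith
    then show "z \<in> ?V" using * by (simp add: z col_index_def)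
  qed
qed

lemma row_space_coefficients:
  fixes M :: "real mat"
  assumes M: "M \<in> carrier_mat n m" and w: "w \<in> vec_space.row_space m M"
  obtains c where "\<And>j. j < m \<Longrightarrow> w $ j = (\<Sum>i<n. c i * M $$ (i, j))"
proof -
  obtain z where z: "z \<in> carrier_vec n" "M\<^sup>T *\<^sub>v z = w"
    using w M unfolding vec_space.row_space_eq[OF M] by auto
  show thesis
  proof (rule that[of "\<lambda>i. z $ i"])
    fix j assume j: "j < m"
    have "w $ j = (\<Sum>i = 0..<n. M $$ (i, j) * z $ i)"
      using j M z by (auto simp: z(2)[symmetric] scalar_prod_def)
    then show "w $ j = (\<Sum>i<n. z $ i * M $$ (i, j))"
      by (simp add: lessThan_atLeast0 mult.commute)
  qed
qed

theorem theorem3p15: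
  fixes m l :: nat and As :: "nat mat list"
    and lam :: "nat \<Rightarrow> nat" and Fs :: "nat set list" and x y :: "nat \<Rightarrow> nat"
    and A B C :: "nat mat"
    and VR :: "(nat \<times> nat \<times> nat) set" and VB VC :: "(nat \<times> nat) set"
    and IA :: "(nat \<times> nat \<times> nat) mpoly set" and IB IC :: "(nat \<times> nat) mpoly set"
    and tB tC :: "nat \<times> nat \<Rightarrow> nat"
  assumes "l \<ge> 1" and "length As = l + 1"
    and "multipartition m As" and "GRIP m As"
    and A: "A = stack m (take l As)"
    and "labeling A lam"
    and B: "B = Cup A lam" and C: "C = As ! l"
    and "floret_list B C Fs"
    and tB: "tB = (\<lambda>(u, s'). floret_of_B B C Fs u)"
    and tC: "tC = (\<lambda>(v, s''). floret_of_C Fs v)"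
    and "\<And>u. u < dim_row B \<Longrightarrow> x u > 0" and "\<And>v. v < dim_row C \<Longrightarrow> y v > 0"
    and "\<And>u v. u < dim_row B \<Longrightarrow> v < dim_row C \<Longrightarrow> omega B C u v \<noteq> 0 \<Longrightarrow>
           omega B C u v = x u * y v"
    and VR: "VR = col_index B C"
    and VB: "VB = (SIGMA u:{..<dim_row B}. {..<x u})"
    and VC: "VC = (SIGMA v:{..<dim_row C}. {..<y v})"
    and IA: "IA = toric_ideal (dim_row (stack m As)) VR
                    (\<lambda>i k. stack m As $$ (i, col_position B C k))"
    and IB: "IB = toric_ideal (dim_row A) VB (tilde_A A lam)"
    and IC: "IC = toric_ideal (dim_row C) VC (tilde_C C)"
  shows "homogeneous_ideal (length Fs) VB (\<lambda>j. unit_vec (length Fs) (tB j)) IB \<and>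
         homogeneous_ideal (length Fs) VC (\<lambda>k. unit_vec (length Fs) (tC k)) IC \<and>
         bij_betw (split_index y) VR (tfp_vars VB tB VC tC) \<and>
         rename_vars (tfp_vars VB tB VC tC) (split_index y)
             ` a_kernel (mpoly_ring VR) (quot_tensor VB IB VC IC) (psi VB IB VC IC y)
           = toric_fiber_product VB tB IB VC tC IC \<and>
         IA = a_kernel (mpoly_ring VR) (quot_tensor VB IB VC IC) (psi VB IB VC IC y)"
proof -
  have dimA: "dim_col A = m" by (simp add: A)
  have As: "As = take l As @ [C]" using take_Suc_conv_app_nth[of l As] \<open>length As = l + 1\<close> C by simp
  have partC: "partition_matrix m C"
    using \<open>multipartition m As\<close> \<open>length As = l + 1\<close> C by (simp add: multipartition_def)
  have partB: "partition_matrix m B"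
    using partition_matrix_Cup[OF \<open>labeling A lam\<close>] by (simp add: B dimA)
  have dims: "dim_col C = m" "dim_col B = m" using partB partC by (simp_all add: partition_matrix_def)
  \<comment> \<open>The GRIP is used at \<open>h = l\<close>; since lists count from 0,
    \<open>As ! l\<close> is partition number l+1.\<close>
  have grip: "floret_condition B C"
    "set (rows (map_mat real (Cap C Fs))) \<subseteq> vec_space.row_space m (map_mat real A)"
    using \<open>GRIP m As\<close>[unfolded GRIP_def, rule_format, of l lam] \<open>l \<ge> 1\<close> \<open>length As = l + 1\<close>
      \<open>labeling A lam\<close> \<open>floret_list B C Fs\<close>
    unfolding Let_def A[symmetric] B[symmetric] C[symmetric] by auto
  interpret florets m B C Fs
    by unfold_locales (rule partB partC grip(1) \<open>floret_list B C Fs\<close>)+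

  have supportB: "row_support B u = {j. j < m \<and> lam j = u}" if "u < dim_row B" for u
    using that by (simp add: B Cup_support dimA)
  have cols_of_form: "cols_of_form B C u v = row_support B u \<inter> row_support C v"
    if "u < dim_row B" "v < dim_row C" for u v
    by (rule cols_of_form_eq[OF partB partC that])
  have "finite (row_support C v)" for v by (simp add: row_support_def)
  then have omega_eq_0_iff: "floret_of_B B C Fs u = floret_of_C Fs v \<longleftrightarrow> omega B C u v \<noteq> 0"
    if "u < dim_row B" "v < dim_row C" for u v
    using that by (simp add: floret_of_B_eq_floret_of_C_iff omega_def cols_of_form connected_rows_def)
  \<comment> \<open>The column picked by \<open>SOME\<close> in \<open>tilde_A\<close> may be
    replaced by any column in the support of row \<open>u\<close> of \<open>B\<close>, because
    columns with the same label are equal.\<close>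
  have tilde_A: "tilde_A A lam i (u, s') = A $$ (i, j)"
    if "i < dim_row A" "u < dim_row B" "j \<in> row_support B u" for i u s' j
  proof -
    define j' where "j' = (SOME j. j < dim_col A \<and> lam j = u)"
    have j: "j < dim_col A \<and> lam j = u" using that by (simp add: supportB dimA)
    then have "j' < dim_col A \<and> lam j' = u" unfolding j'_def by (rule someI)
    then have "col A j = col A j'" using \<open>labeling A lam\<close> j by (auto simp: labeling_def)
    then have "col A j $ i = col A j' $ i" by simp
    then show ?thesis
      using j \<open>j' < dim_col A \<and> lam j' = u\<close> \<open>i < dim_row A\<close> by (simp add: tilde_A_def j'_def)
  qed
  have finB: "finite VB" and finC: "finite VC" by (simp_all add: VB VC)

  \<comment> \<open>The row space condition writes row \<open>t\<close> of the floret matrix as a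
    combination of the rows of \<open>A\<close>. The bound on \<open>t\<close> stands inside the
    existential so that \<open>choice\<close> yields one family of coefficients.\<close>
  have "\<exists>c. t < length Fs \<longrightarrow> (\<forall>j<m. real (Cap C Fs $$ (t, j)) = (\<Sum>i<dim_row A. c i * real (A $$ (i, j))))" for t
  proof (cases "t < length Fs")
    case t: True
    then have "row (map_mat real (Cap C Fs)) t \<in> set (rows (map_mat real (Cap C Fs)))"
      by (simp add: rows_def Cap_def)
    then have row: "row (map_mat real (Cap C Fs)) t \<in> vec_space.row_space m (map_mat real A)"
      using grip(2) by blast
    have "map_mat real A \<in> carrier_mat (dim_row A) m" using dimA by auto
    then obtain c where
      "\<And>j. j < m \<Longrightarrow> row (map_mat real (Cap C Fs)) t $ j = (\<Sum>i<dim_row A. c i * map_mat real A $$ (i, j))"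
      using row_space_coefficients[OF _ row] by blast
    then show ?thesis using t dims dimA by (intro exI[of _ c]) (simp add: Cap_def)
  qed simp
  from choice[OF allI[OF this]] obtain c where
    "\<forall>t. t < length Fs \<longrightarrow> (\<forall>j<m. real (Cap C Fs $$ (t, j)) = (\<Sum>i<dim_row A. c t i * real (A $$ (i, j))))" ..
  then have c: "real (Cap C Fs $$ (t, j)) = (\<Sum>i<dim_row A. c t i * real (A $$ (i, j)))"
    if "t < length Fs" "j < m" for t j using that by simp
  have homB: "homogeneous_ideal (length Fs) VB (\<lambda>j. unit_vec (length Fs) (tB j)) IB"
    unfolding IB
  proof (rule homogeneous_toric_ideal[OF finB, where c = c])
    fix k t assume "k \<in> VB" and t: "t < length Fs"
    then obtain u s' where k: "k = (u, s')" and u: "u < dim_row B" by (auto simp: VB)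
    \<comment> \<open>Any column labelled \<open>u\<close> represents the column
      \<open>(u, s')\<close> of \<open>tilde_A\<close>, and its entries in the floret matrix are the
      degree of that variable.\<close>
    obtain j where j: "j \<in> row_support B u" using partition_matrix_support_nonempty[OF partB u] by blast
    then have "j < m" using u by (simp add: supportB)
    have "real_of_int (unit_vec (length Fs) (tB k) $ t) = real (Cap C Fs $$ (t, j))"
      using t by (simp add: Cap_entry[OF u j t] k tB unit_vec_def)
    also have "\<dots> = (\<Sum>i<dim_row A. c t i * real (tilde_A A lam i k))"
      using c[OF t \<open>j < m\<close>] by (simp add: k tilde_A[OF _ u j])
    finally show "real_of_int (unit_vec (length Fs) (tB k) $ t)
      = (\<Sum>i<dim_row A. c t i * real (tilde_A A lam i k))" .
  qed
  have homC: "homogeneous_ideal (length Fs) VC (\<lambda>k. unit_vec (length Fs) (tC k)) IC"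
    unfolding IC
  \<comment> \<open>The column \<open>(v, s'')\<close> of \<open>tilde_C\<close> is a unit vector,
    so summing its entries over the rows in floret \<open>t\<close> gives 1 exactly when
    \<open>v\<close> is in that floret. The coefficients are therefore the indicator of the
    floret.\<close>
  proof (rule homogeneous_toric_ideal[OF finC, where c = "\<lambda>t v. if floret_of_C Fs v = t then 1 else 0"])
    fix k t assume "k \<in> VC" and t: "t < length Fs"
    then obtain v s'' where k: "k = (v, s'')" and v: "v < dim_row C" by (auto simp: VC)
    have "(\<Sum>i<dim_row C. (if floret_of_C Fs i = t then 1 else 0) * real (tilde_C C i k))
        = (\<Sum>i<dim_row C. if i = v then (if floret_of_C Fs v = t then 1 else 0) else 0)"
      by (rule sum.cong) (auto simp: k tilde_C_def unit_vec_def)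
    also have "\<dots> = real_of_int (unit_vec (length Fs) (tC k) $ t)"
      using v t by (auto simp: k tC unit_vec_def)
    finally show "real_of_int (unit_vec (length Fs) (tC k) $ t)
        = (\<Sum>i<dim_row C. (if floret_of_C Fs i = t then 1 else 0) * real (tilde_C C i k))" by simp
  qed
  have bij: "bij_betw (split_index y) VR (tfp_vars VB tB VC tC)"
    unfolding VR VB VC tB tC
    by (rule bij_betw_split_index) (use assms omega_eq_0_iff in auto)

  \<comment> \<open>The two weights are placed in different coordinates of a product, so their sum
    determines each of them, as \<open>independent\<close> demands.\<close>
  define wB where "wB a = (toric_weight (dim_row A) VB (tilde_A A lam) a, 0 :: nat \<Rightarrow> nat)" for a
  define wC where "wC b = (0 :: nat \<Rightarrow> nat, toric_weight (dim_row C) VC (tilde_C C) b)" for b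
  have w_add: "wB (a + a') = wB a + wB a'" "wC (b + b') = wC b + wC b'" for a a' b b'
    by (simp_all add: wB_def wC_def toric_weight_add)
  have IB_eq: "IB = {p \<in> carrier (mpoly_ring VB). pushforward wB p = 0}"
    unfolding IB by (rule toric_ideal_eq_kernel) (simp_all add: w_add, simp add: wB_def toric_weight_eq_iff)
  have IC_eq: "IC = {p \<in> carrier (mpoly_ring VC). pushforward wC p = 0}"
    unfolding IC by (rule toric_ideal_eq_kernel) (simp_all add: w_add, simp add: wC_def toric_weight_eq_iff)
  interpret T: monomial_tensor VB IB VC IC wB wC
    by unfold_locales (rule w_add IB_eq IC_eq | simp add: wB_def wC_def toric_weight_zero zero_prod_def)+

  let ?T = "quot_tensor VB IB VC IC"
  let ?Z = "tfp_vars VB tB VC tC"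
  \<comment> \<open>On exponent vectors over pairs of variables this is the weight of the toric
    fiber product; precomposed with the renaming by \<open>split_index\<close> it is the weight of
    \<open>psi\<close>.\<close>
  define w where "w a = wB (pushforward fst a) + wC (pushforward snd a)" for a :: "(nat \<times> nat) \<times> nat \<times> nat \<Rightarrow>\<^sub>0 nat"
  have w_split: "w (pushforward (split_index y) a)
      = wB (pushforward (\<lambda>k. fst (split_index y k)) a) + wC (pushforward (\<lambda>k. snd (split_index y k)) a)" for a
    by (simp add: w_def pushforward_pushforward)
  have sub: "split_index y ` VR \<subseteq> ?Z" using bij by (simp add: bij_betw_def)
  have fst_sub: "fst ` ?Z \<subseteq> VB" and snd_sub: "snd ` ?Z \<subseteq> VC" by (auto simp: tfp_vars_def)
  have fst_split: "(\<lambda>k. fst (split_index y k)) ` VR \<subseteq> VB" using sub fst_sub by blast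
  have snd_split: "(\<lambda>k. snd (split_index y k)) ` VR \<subseteq> VC" using sub snd_sub by blast
  have ker: "a_kernel (mpoly_ring VR) ?T (psi VB IB VC IC y)
      = {p \<in> carrier (mpoly_ring VR). pushforward (\<lambda>a. w (pushforward (split_index y) a)) p = 0}"
    unfolding a_kernel_def' psi_def case_prod_beta w_split
    using T.mpoly_eval_eq_zero_iff[OF _ fst_split snd_split] by blast
  have tfp: "toric_fiber_product VB tB IB VC tC IC
      = {q \<in> carrier (mpoly_ring ?Z). pushforward w q = 0}"
    unfolding toric_fiber_product_def a_kernel_def' case_prod_beta w_def[abs_def]
    using T.mpoly_eval_eq_zero_iff[OF _ fst_sub snd_sub] by blast

  have finR: "finite VR"
    using bij_betw_finite[OF bij] finB finC finite_subset[of ?Z "VB \<times> VC"] by (auto simp: tfp_vars_def)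
  let ?n = "dim_row A" and ?M = "\<lambda>i k. stack m As $$ (i, col_position B C k)"
  have dim_stack: "dim_row (stack m As) = ?n + dim_row C"
    by (subst As) (simp add: A)
  have stack_entry: "stack m As $$ (i, j) = (if i < ?n then A $$ (i, j) else C $$ (i - ?n, j))"
    if "i < ?n + dim_row C" "j < m" for i j
    using stack_append_entry[of C m i "take l As" j] that As dims by (simp flip: A)
  have entry: "?M i k = (if i < ?n then tilde_A A lam i (fst (split_index y k))
        else tilde_C C (i - ?n) (snd (split_index y k)))"
    if "k \<in> VR" "i < ?n + dim_row C" for i k
  proof -
    obtain u v s where k: "k = (u, v, s)" and uv: "u < dim_row B" "v < dim_row C" and s: "s < omega B C u v"
      using \<open>k \<in> VR\<close> by (auto simp: VR col_index_def)
    let ?j = "col_position B C k"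
    have "finite (cols_of_form B C u v)" by (simp add: cols_of_form_def)
    then have "?j \<in> cols_of_form B C u v"
      \<comment> \<open>The bound \<open>s < omega B C u v\<close> keeps the list access within
        range, so the position really is a column of the required form.\<close>
      using s nth_mem[of s "sorted_list_of_set (cols_of_form B C u v)"]
      by (simp add: k col_position_def omega_def)
    then have j: "?j \<in> row_support B u" "?j \<in> row_support C v" using uv by (auto simp: cols_of_form)
    then have "?j < m" using uv by (simp add: supportB)
    show ?thesis
    proof (cases "i < ?n")
      case True
      then show ?thesis
        using stack_entry[OF that(2) \<open>?j < m\<close>] tilde_A[OF True uv(1) j(1)] by (simp add: k split_index_def)
    next
      case False
      then have "i - ?n < dim_row C" using that(2) by simp
      then show ?thesis
        using stack_entry[OF that(2) \<open>?j < m\<close>] False partition_matrix_entry[OF partC uv(2) _ j(2), of "i - ?n"]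
        by (simp add: k split_index_def tilde_C_def unit_vec_def)
    qed
  qed
  have "IA = {p \<in> carrier (mpoly_ring VR). pushforward (\<lambda>a. w (pushforward (split_index y) a)) p = 0}"
    unfolding IA
  proof (rule toric_ideal_eq_kernel)
    show "w (pushforward (split_index y) (a + b)) = w (pushforward (split_index y) a) + w (pushforward (split_index y) b)" for a b
      by (simp add: w_def pushforward_add w_add ac_simps)
    fix a b :: "nat \<times> nat \<times> nat \<Rightarrow>\<^sub>0 nat"
    assume ab: "Poly_Mapping.keys a \<subseteq> VR" "Poly_Mapping.keys b \<subseteq> VR"
    have sum1: "(\<Sum>x\<in>VB. tilde_A A lam i x * Poly_Mapping.lookup (pushforward (\<lambda>k. fst (split_index y k)) a) x)
        = (\<Sum>k\<in>VR. ?M i k * Poly_Mapping.lookup a k)"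
      if "Poly_Mapping.keys a \<subseteq> VR" "i < ?n" for i a
      unfolding sum_mult_lookup_pushforward[OF finB finR that(1) fst_split]
      using that(2) by (intro sum.cong refl) (simp add: entry)
    have sum2: "(\<Sum>x\<in>VC. tilde_C C i x * Poly_Mapping.lookup (pushforward (\<lambda>k. snd (split_index y k)) a) x)
        = (\<Sum>k\<in>VR. ?M (?n + i) k * Poly_Mapping.lookup a k)"
      if "Poly_Mapping.keys a \<subseteq> VR" "i < dim_row C" for i a
      unfolding sum_mult_lookup_pushforward[OF finC finR that(1) snd_split]
      using that(2) by (intro sum.cong refl) (simp add: entry)
    \<comment> \<open>The first coordinate of the weight collects the upper rows of the stacked
      matrix, the second the rows of \<open>C\<close>, which begin at row \<open>?n\<close>.\<close>
    have "w (pushforward (split_index y) a) = w (pushforward (split_index y) b) \<longleftrightarrow>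
      (\<forall>i<?n. (\<Sum>k\<in>VR. ?M i k * Poly_Mapping.lookup a k) = (\<Sum>k\<in>VR. ?M i k * Poly_Mapping.lookup b k)) \<and>
      (\<forall>i<dim_row C. (\<Sum>k\<in>VR. ?M (?n + i) k * Poly_Mapping.lookup a k) = (\<Sum>k\<in>VR. ?M (?n + i) k * Poly_Mapping.lookup b k))"
      unfolding w_split by (simp add: wB_def wC_def toric_weight_eq_iff sum1 sum2 ab)
    also have "\<dots> \<longleftrightarrow> (\<forall>i<dim_row (stack m As).
        (\<Sum>k\<in>VR. ?M i k * Poly_Mapping.lookup a k) = (\<Sum>k\<in>VR. ?M i k * Poly_Mapping.lookup b k))"
      unfolding dim_stack
    proof (intro iffI allI impI conjI; (elim conjE)?)
      fix i
      assume 1: "\<forall>i<?n. (\<Sum>k\<in>VR. ?M i k * Poly_Mapping.lookup a k) = (\<Sum>k\<in>VR. ?M i k * Poly_Mapping.lookup b k)"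
        and 2: "\<forall>i<dim_row C. (\<Sum>k\<in>VR. ?M (?n + i) k * Poly_Mapping.lookup a k) = (\<Sum>k\<in>VR. ?M (?n + i) k * Poly_Mapping.lookup b k)"
        and i: "i < ?n + dim_row C"
      show "(\<Sum>k\<in>VR. ?M i k * Poly_Mapping.lookup a k) = (\<Sum>k\<in>VR. ?M i k * Poly_Mapping.lookup b k)"
        using 1[rule_format, of i] 2[rule_format, of "i - ?n"] i by (cases "i < ?n") simp_all
    qed simp_all
    finally show "w (pushforward (split_index y) a) = w (pushforward (split_index y) b) \<longleftrightarrow>
      (\<forall>i<dim_row (stack m As). (\<Sum>k\<in>VR. ?M i k * Poly_Mapping.lookup a k) = (\<Sum>k\<in>VR. ?M i k * Poly_Mapping.lookup b k))" .
  qed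
  \<comment> \<open>The toric ideal and the kernel of \<open>psi\<close> are now the same set, and
    renaming along the bijection carries it to the toric fiber product.\<close>
  then show ?thesis
    using homB homC bij rename_vars_image_kernel[OF bij, of w] ker tfp by simp
qed

end
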